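(* Let $\Bbbk$ be a commutative unital ring and $n \geq 1$, $d \geq 2$ integers. Then $NC_A(n,d)$ is a free $\Bbbk$-module with basis consisting of the $n!\,(1+n(d-1))$ elements $\{T_w : w \in S_n\} \sqcup \{T_w T_n^k T_{n-1} T_{n-2} \cdots T_{m+1} T_m : w \in S_n,\ k \in [1,d-1],\ m \in [1,n]\}$ (where for $m = n$ the product $T_{n-1}\cdots T_m$ is empty). Moreover, for every $l \in [1,n-1]$, the subalgebra $R_l$ of $NC_A(n,d)$ generated by $T_1,\dots,T_l$ is isomorphic to the usual nil-Coxeter algebra of type $A_l$, i.e. the algebra generated by $T_1,\dots,T_l$ with the type $A$ braid relations and $T_i^2 = 0$ for all $i$.
   Context: $NC_A(n,d)$ is the $\Bbbk$-algebra generated by $T_1,\dots,T_n$ with relations $T_iT_{i+1}T_i = T_{i+1}T_iT_{i+1}$ for $0<i<n$, $T_iT_j = T_jT_i$ for $|i-j|>1$, $T_1^2 = \cdots = T_{n-1}^2 = 0$, and $T_n^d = 0$. The symmetric group $S_n$ is generated by simple transpositions $s_1,\dots,s_{n-1}$; for $w \in S_n$ with reduced expression $w = s_{i_1}\cdots s_{i_r}$, $T_w := T_{i_1}\cdots T_{i_r}$ (independent of the reduced expression by the braid relations). *)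

theory Defs
  imports "HOL-Combinatorics.Combinatorics"
begin

text \<open>Free associative algebra over a commutative ring 'k on letters (nat):
  elements are functions from words (nat lists) to 'k; we only use finitely supported ones.\<close>

type_synonym 'k fa = "nat list \<Rightarrow> 'k"

definition fsupp :: "'k::zero fa \<Rightarrow> bool" where
  "fsupp f \<longleftrightarrow> finite {w. f w \<noteq> 0}"

definition in_FA :: "nat set \<Rightarrow> 'k::zero fa \<Rightarrow> bool" where
  "in_FA L f \<longleftrightarrow> fsupp f \<and> (\<forall>w. f w \<noteq> 0 \<longrightarrow> set w \<subseteq> L)"

definition mon :: "nat list \<Rightarrow> 'k::{zero,one} fa" where
  "mon u = (\<lambda>w. if w = u then 1 else 0)"

definition fadd :: "'k::plus fa \<Rightarrow> 'k fa \<Rightarrow> 'k fa" where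
  "fadd f g = (\<lambda>w. f w + g w)"

definition fsub :: "'k::minus fa \<Rightarrow> 'k fa \<Rightarrow> 'k fa" where
  "fsub f g = (\<lambda>w. f w - g w)"

definition fsmul :: "'k::times \<Rightarrow> 'k fa \<Rightarrow> 'k fa" where
  "fsmul c f = (\<lambda>w. c * f w)"

text \<open>Multiplication (concatenation of words, extended bilinearly).\<close>
definition fmul :: "'k::comm_ring_1 fa \<Rightarrow> 'k fa \<Rightarrow> 'k fa" where
  "fmul f g = (\<lambda>w. \<Sum>i\<le>length w. f (take i w) * g (drop i w))"

inductive_set gen_ideal :: "nat set \<Rightarrow> 'k::comm_ring_1 fa set \<Rightarrow> 'k fa set"
  for L :: "nat set" and R :: "'k fa set" where
  gen: "r \<in> R \<Longrightarrow> r \<in> gen_ideal L R"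
| zero: "(\<lambda>_. 0) \<in> gen_ideal L R"
| add: "x \<in> gen_ideal L R \<Longrightarrow> y \<in> gen_ideal L R \<Longrightarrow> fadd x y \<in> gen_ideal L R"
| smul: "x \<in> gen_ideal L R \<Longrightarrow> fsmul c x \<in> gen_ideal L R"
| lmul: "x \<in> gen_ideal L R \<Longrightarrow> set u \<subseteq> L \<Longrightarrow> fmul (mon u) x \<in> gen_ideal L R"
| rmul: "x \<in> gen_ideal L R \<Longrightarrow> set u \<subseteq> L \<Longrightarrow> fmul x (mon u) \<in> gen_ideal L R"

definition braid_rels :: "nat \<Rightarrow> 'k::comm_ring_1 fa set" where
  "braid_rels l =
     {fsub (mon [i, Suc i, i]) (mon [Suc i, i, Suc i]) | i. 0 < i \<and> i < l}
   \<union> {fsub (mon [i, j]) (mon [j, i]) | i j. i \<in> {1..l} \<and> j \<in> {1..l} \<and>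
        (i + 1 < j \<or> j + 1 < i)}"

definition NCA_rels :: "nat \<Rightarrow> nat \<Rightarrow> 'k::comm_ring_1 fa set" where
  "NCA_rels n d = braid_rels n \<union> {mon [i, i] | i. 1 \<le> i \<and> i \<le> n - 1}
                   \<union> {mon (replicate d n)}"

definition NCA_ideal :: "nat \<Rightarrow> nat \<Rightarrow> 'k::comm_ring_1 fa set" where
  "NCA_ideal n d = gen_ideal {1..n} (NCA_rels n d)"

definition NC_rels :: "nat \<Rightarrow> 'k::comm_ring_1 fa set" where
  "NC_rels l = braid_rels l \<union> {mon [i, i] | i. 1 \<le> i \<and> i \<le> l}"

definition NC_ideal :: "nat \<Rightarrow> 'k::comm_ring_1 fa set" where
  "NC_ideal l = gen_ideal {1..l} (NC_rels l)"

definition perm_of_word :: "nat list \<Rightarrow> nat \<Rightarrow> nat" where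
  "perm_of_word ws = foldr (\<lambda>i p. Transposition.transpose i (Suc i) \<circ> p) ws id"

definition is_reduced_word :: "nat \<Rightarrow> (nat \<Rightarrow> nat) \<Rightarrow> nat list \<Rightarrow> bool" where
  "is_reduced_word n w ws \<longleftrightarrow> set ws \<subseteq> {1..<n} \<and> perm_of_word ws = w \<and>
     (\<forall>vs. set vs \<subseteq> {1..<n} \<and> perm_of_word vs = w \<longrightarrow> length ws \<le> length vs)"

text \<open>A chosen reduced expression of w \<in> S_n; T_w is the corresponding monomial.\<close>
definition red_word :: "nat \<Rightarrow> (nat \<Rightarrow> nat) \<Rightarrow> nat list" where
  "red_word n w = (SOME ws. is_reduced_word n w ws)"

definition basis_word :: "nat \<Rightarrow> (nat \<Rightarrow> nat) \<times> (nat \<times> nat) option \<Rightarrow> nat list" where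
  "basis_word n x = (case x of
      (w, None) \<Rightarrow> red_word n w
    | (w, Some (k, m)) \<Rightarrow> red_word n w @ replicate k n @ rev [m..<n])"

definition basis_index :: "nat \<Rightarrow> nat \<Rightarrow> ((nat \<Rightarrow> nat) \<times> (nat \<times> nat) option) set" where
  "basis_index n d =
     {(w, None) | w. w permutes {1..n}}
   \<union> {(w, Some (k, m)) | w k m. w permutes {1..n} \<and> k \<in> {1..d-1} \<and> m \<in> {1..n}}"

end

theory Submission
  imports Defs
begin

text \<open>All relations identify two words or annihilate one, so the algebra is spanned by the
  classes of words. Moving one letter at a time to the left shows that every word vanishes or is
  braid equivalent to a basis word; for words in $T_1, \<dots>, T_{n-1}$ the normal forms so obtained
  are in bijection with $S_n$, and therefore any two reduced words of a permutation are braid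
  equivalent. Conversely, right multiplication by the generators on the claimed
  basis is given by explicit formulas which define a partial action satisfying all relations.
  Since the word of a basis index carries the unit to that index, the coefficient functionals of
  this action vanish on the ideal and separate the basis. The same functionals show that
  the nil-Coxeter algebra of type $A_l$ embeds.\<close>

section \<open>Braid equivalence of words\<close>

text \<open>The delicate point is how T_n re-enters after a tail T_n^k T_{n-1} ... T_m with m < n.
  For k = 1 the braid relation T_n T_{n-1} T_n = T_{n-1} T_n T_{n-1} lets the new letter leave the
  tail on the left as T_{n-1}, where T_w absorbs it. For k = 2 the same move, applied twice, gives
  T_n^2 T_{n-1} T_n = T_n T_{n-1} T_n T_{n-1} = T_{n-1} T_n T_{n-1}^2 = 0, and larger k follow.
  Hence a normal form contains just one power of T_n, whatever d is, and the action has an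
  asymmetric clause separating \<open>k = 1\<close> from \<open>k \<noteq> 1\<close>. Spanning alone
  bounds the algebra only from above; the lower bound requires a representation. Since every
  generator sends a basis element to a basis element or to zero, a partial function on indices
  suffices, and its coefficient functionals take only the values 0 and 1 on words, so the argument
  is the same over every ring.\<close>

inductive beq :: "nat \<Rightarrow> nat list \<Rightarrow> nat list \<Rightarrow> bool" for l where
  reflI: "beq l u u"
| symI: "beq l u v \<Longrightarrow> beq l v u"
| transI: "beq l u v \<Longrightarrow> beq l v w \<Longrightarrow> beq l u w"
| braid: "0 < i \<Longrightarrow> i < l \<Longrightarrow> beq l (p @ [i, Suc i, i] @ q) (p @ [Suc i, i, Suc i] @ q)"
| comm: "i \<in> {1..l} \<Longrightarrow> j \<in> {1..l} \<Longrightarrow> i + 1 < j \<Longrightarrow> beq l (p @ [i, j] @ q) (p @ [j, i] @ q)"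

lemma beq_context: "beq l u v \<Longrightarrow> beq l (p @ u @ q) (p @ v @ q)"
proof (induction rule: beq.induct)
  case (braid i p' q')
  then show ?case using beq.braid[of i l "p @ p'" "q' @ q"] by simp
next
  case (comm i j p' q')
  then show ?case using beq.comm[of i l j "p @ p'" "q' @ q"] by simp
qed (auto intro: beq.intros)

lemma beq_left: "beq l u v \<Longrightarrow> beq l (p @ u) (p @ v)"
  using beq_context[of l u v p "[]"] by simp

lemma beq_right: "beq l u v \<Longrightarrow> beq l (u @ q) (v @ q)"
  using beq_context[of l u v "[]" q] by simp

lemma beq_mono: "beq l u v \<Longrightarrow> l \<le> l' \<Longrightarrow> beq l' u v"
  by (induction rule: beq.induct) (auto intro: beq.reflI beq.symI beq.transI beq.braid[simplified] beq.comm[simplified])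

lemma beq_set: "beq l u v \<Longrightarrow> set u = set v"
  by (induction rule: beq.induct) auto

text \<open>The nil relations are kept out of \<open>beq\<close>, so length is an invariant; this
  lets \<open>reduced_word_not_square\<close> compare a square with a strictly shorter word.\<close>

lemma beq_length: "beq l u v \<Longrightarrow> length u = length v"
  by (induction rule: beq.induct) auto

lemma beq_swap:
  assumes "i \<in> {1..l}" "j \<in> {1..l}" "i + 1 < j \<or> j + 1 < i"
  shows "beq l [i, j] [j, i]"
  using assms beq.comm[of i l j "[]" "[]"] beq.comm[of j l i "[]" "[]"] by (auto intro: beq.symI)

lemma beq_commute_letter:
  assumes "i \<in> {1..l}" "\<And>j. j \<in> set u \<Longrightarrow> j \<in> {1..l} \<and> (i + 1 < j \<or> j + 1 < i)"
  shows "beq l (u @ [i]) (i # u)"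
  using assms(2)
proof (induction u)
  case Nil
  then show ?case by (simp add: beq.reflI)
next
  case (Cons j u)
  have "beq l (j # u @ [i]) (j # i # u)"
    using Cons beq_left[of l "u @ [i]" "i # u" "[j]"] by simp
  moreover have "beq l (j # i # u) (i # j # u)"
    using Cons.prems[of j] assms(1) beq_right[OF beq_swap[of j l i], of u] by auto
  ultimately show ?case by (auto intro: beq.transI)
qed

lemma beq_rev_upt_less:
  assumes "1 \<le> i" "Suc i < m" "m \<le> N" "N \<le> Suc l"
  shows "beq l (rev [m..<N] @ [i]) (i # rev [m..<N])"
  using assms by (intro beq_commute_letter) auto

text \<open>The new \<open>i\<close> moves left past all letters below \<open>i - 1\<close> and
  meets \<open>i, i - 1\<close>; the braid move turns \<open>i, i - 1, i\<close> into
  \<open>i - 1, i, i - 1\<close>, and the leading \<open>i - 1\<close> commutes with everything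
  above \<open>i\<close>. This shift by one is the origin of \<open>i - 1\<close> in the
  action.\<close>

lemma beq_rev_upt_greater:
  assumes "1 \<le> m" "m < i" "i < N" "N \<le> Suc l"
  shows "beq l (rev [m..<N] @ [i]) ((i - 1) # rev [m..<N])"
proof -
  define j where "j = i - 1"
  have i: "i = Suc j" using assms by (simp add: j_def)
  have "[m..<N] = [m..<j] @ [j, i] @ [Suc i..<N]"
    using assms by (metis append.assoc append_Cons append_Nil i le_add_diff_inverse less_Suc_eq_le less_imp_le_nat upt_add_eq_append upt_conv_Cons Suc_leI Suc_lessD)
  then have r: "rev [m..<N] = rev [Suc i..<N] @ [i, j] @ rev [m..<j]" by simp
  have "beq l (rev [m..<j] @ [i]) (i # rev [m..<j])"
    using assms i by (intro beq_commute_letter) auto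
  then have 1: "beq l (rev [m..<N] @ [i]) (rev [Suc i..<N] @ [i, j, i] @ rev [m..<j])"
    using beq_left[of l "rev [m..<j] @ [i]" "i # rev [m..<j]" "rev [Suc i..<N] @ [i, j]"] by (simp add: r)
  have 2: "beq l (rev [Suc i..<N] @ [i, j, i] @ rev [m..<j]) (rev [Suc i..<N] @ [j, i, j] @ rev [m..<j])"
    unfolding i using assms i by (intro beq.symI[OF beq.braid]) auto
  have "beq l (rev [Suc i..<N] @ [j]) (j # rev [Suc i..<N])"
    using assms i by (intro beq_commute_letter) auto
  then have 3: "beq l (rev [Suc i..<N] @ [j, i, j] @ rev [m..<j]) (j # rev [m..<N])"
    using beq_right[of l "rev [Suc i..<N] @ [j]" "j # rev [Suc i..<N]" "[i, j] @ rev [m..<j]"] by (simp add: r)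
  show ?thesis using 1 2 3 beq.transI unfolding j_def by blast
qed

section \<open>Canonical words and reduced words of permutations\<close>

text \<open>Vanishing through T_i^2 = 0, expressed on words alone: no coefficients and no exponent d
  enter until the permutation combinatorics is settled.\<close>

definition has_square :: "nat \<Rightarrow> nat list \<Rightarrow> bool" where
  "has_square l u \<longleftrightarrow> (\<exists>p i q. i \<in> {1..l} \<and> beq l u (p @ [i, i] @ q))"

lemma has_square_beq: "has_square l v \<Longrightarrow> beq l u v \<Longrightarrow> has_square l u"
  unfolding has_square_def by (meson beq.transI)

lemma has_square_context: "has_square l u \<Longrightarrow> has_square l (p @ u @ q)"
  unfolding has_square_def by (metis append.assoc beq_context)

lemma has_square_mono: "has_square l u \<Longrightarrow> l \<le> l' \<Longrightarrow> has_square l' u"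
  unfolding has_square_def by (meson atLeastAtMost_iff beq_mono order_trans)

text \<open>Normal forms for $S_{l+1}$, built from the minimal representatives
  $s_l s_{l-1} \cdots s_m$ of the cosets of $S_l$.\<close>

primrec canon :: "nat \<Rightarrow> nat list set" where
  "canon 0 = {[]}"
| "canon (Suc l) = {c @ rev [m..<Suc (Suc l)] | c m. c \<in> canon l \<and> m \<in> {1..Suc (Suc l)}}"

lemma canon_letters: "c \<in> canon l \<Longrightarrow> set c \<subseteq> {1..l}"
proof (induction l arbitrary: c)
  case (Suc l)
  then obtain c' m where c: "c = c' @ rev [m..<Suc (Suc l)]" "c' \<in> canon l" "m \<in> {1..Suc (Suc l)}"
    by auto
  have "set c' \<subseteq> {1..Suc l}" using Suc.IH[OF c(2)] by auto
  then show ?case using c by auto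
qed simp

lemma Nil_in_canon: "[] \<in> canon l"
proof (induction l)
  case (Suc l)
  then show ?case by (auto intro!: exI[of _ "[]"] exI[of _ "Suc (Suc l)"])
qed simp

lemma canon_snoc:
  assumes "c \<in> canon l" "i \<in> {1..l}"
  shows "has_square l (c @ [i]) \<or> (\<exists>c'\<in>canon l. beq l (c @ [i]) c')"
  using assms
proof (induction l arbitrary: c i)
  case 0
  then show ?case by simp
next
  case (Suc l)
  from Suc.prems(1) obtain c0 m where c: "c = c0 @ rev [m..<Suc (Suc l)]"
    and c0: "c0 \<in> canon l" and m: "m \<in> {1..Suc (Suc l)}" by auto
  let ?r = "rev [m..<Suc (Suc l)]"
  \<comment> \<open>Both cases in which \<open>i\<close> passes the block end alike: it reappears
    left of the block as a letter \<open>j \<le> l\<close>, where the induction hypothesis applies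
    to \<open>c0 @ [j]\<close>.\<close>
  have move: ?case if b: "beq (Suc l) (?r @ [i]) (j # ?r)" and j: "j \<in> {1..l}" for j
  proof -
    have b': "beq (Suc l) (c @ [i]) ((c0 @ [j]) @ ?r)"
      using beq_left[OF b, of c0] by (simp add: c)
    from Suc.IH[OF c0 j] show ?thesis
    proof
      assume "has_square l (c0 @ [j])"
      then have "has_square (Suc l) ((c0 @ [j]) @ ?r)"
        using has_square_context[of "Suc l" "c0 @ [j]" "[]" ?r] has_square_mono[of l _ "Suc l"] by simp
      then show ?thesis using b' has_square_beq by blast
    next
      assume "\<exists>c'\<in>canon l. beq l (c0 @ [j]) c'"
      then obtain c' where c': "c' \<in> canon l" "beq l (c0 @ [j]) c'" by blast
      have "beq (Suc l) (c @ [i]) (c' @ ?r)"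
        using b' beq_right[OF beq_mono[OF c'(2), of "Suc l"], of ?r] by (auto intro: beq.transI)
      moreover have "c' @ ?r \<in> canon (Suc l)" using c'(1) m by auto
      ultimately show ?thesis by blast
    qed
  qed
  consider "Suc i < m" | "Suc i = m" | "i = m" | "m < i" by linarith
  then show ?case
  proof cases
    case 1
    then show ?thesis using Suc.prems m by (intro move[of i] beq_rev_upt_less) auto
  next
    case 2
    have "c @ [i] = c0 @ rev [i..<Suc (Suc l)]"
      using 2 m Suc.prems by (simp add: c upt_conv_Cons del: upt_Suc)
    moreover have "c0 @ rev [i..<Suc (Suc l)] \<in> canon (Suc l)"
      using c0 Suc.prems(2) unfolding canon.simps by fastforce
    ultimately show ?thesis using beq.reflI by metis
  next
    case 3
    have "c @ [i] = (c0 @ rev [Suc i..<Suc (Suc l)]) @ [i, i] @ []"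
      using 3 m Suc.prems by (simp add: c upt_conv_Cons del: upt_Suc)
    then show ?thesis unfolding has_square_def using Suc.prems(2) beq.reflI by metis
  next
    case 4
    then show ?thesis using Suc.prems m by (intro move[of "i - 1"] beq_rev_upt_greater) auto
  qed
qed

lemma word_canon:
  "set u \<subseteq> {1..l} \<Longrightarrow> has_square l u \<or> (\<exists>c\<in>canon l. beq l u c)"
proof (induction u rule: rev_induct)
  case Nil
  then show ?case using Nil_in_canon beq.reflI by blast
next
  case (snoc i u)
  then have "has_square l u \<or> (\<exists>c\<in>canon l. beq l u c)" by simp
  then show ?case
  proof
    assume "has_square l u"
    then show ?thesis using has_square_context[of l u "[]" "[i]"] by simp
  next
    assume "\<exists>c\<in>canon l. beq l u c"
    then obtain c where "c \<in> canon l" "beq l (u @ [i]) (c @ [i])" using beq_right by blast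
    then show ?thesis using canon_snoc[of c l i] snoc.prems
      by (auto intro: has_square_beq beq.transI)
  qed
qed

section \<open>Permutations of words and uniqueness of canonical words\<close>

lemma perm_of_word_Nil [simp]: "perm_of_word [] = id"
  by (simp add: perm_of_word_def)

lemma perm_of_word_Cons: "perm_of_word (i # u) = transpose i (Suc i) \<circ> perm_of_word u"
  by (simp add: perm_of_word_def)

lemma perm_of_word_append: "perm_of_word (u @ v) = perm_of_word u \<circ> perm_of_word v"
  by (induction u) (simp_all add: perm_of_word_Cons comp_assoc)

lemma perm_of_word_permutes: "set u \<subseteq> {1..l} \<Longrightarrow> perm_of_word u permutes {1..Suc l}"
  by (induction u)
    (auto simp: perm_of_word_Cons permutes_id intro!: permutes_compose permutes_swap_id)

lemma perm_of_word_beq: "beq l u v \<Longrightarrow> perm_of_word u = perm_of_word v"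
proof (induction rule: beq.induct)
  case (braid i p q)
  have "perm_of_word [i, Suc i, i] = perm_of_word [Suc i, i, Suc i]"
    by (auto simp: perm_of_word_Cons transpose_def fun_eq_iff)
  then show ?case by (metis perm_of_word_append)
next
  case (comm i j p q)
  then have "perm_of_word [i, j] = perm_of_word [j, i]"
    by (auto simp: perm_of_word_Cons transpose_def fun_eq_iff)
  then show ?case by (metis perm_of_word_append)
qed auto

lemma perm_of_word_square: "perm_of_word (p @ [i, i] @ q) = perm_of_word (p @ q)"
  by (simp add: perm_of_word_append perm_of_word_Cons flip: comp_assoc)

lemma perm_of_word_rev_upt:
  "m \<le> N \<Longrightarrow> perm_of_word (rev [m..<N]) m = N"
  by (induction N rule: dec_induct) (simp_all add: perm_of_word_Cons)

lemma perm_of_word_fixes_greater: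
  "set u \<subseteq> {1..l} \<Longrightarrow> Suc l < x \<Longrightarrow> perm_of_word u x = x"
  by (meson atLeastAtMost_iff not_le perm_of_word_permutes permutes_not_in)

text \<open>The last block can be read off the permutation: \<open>?r m\<close> sends
  \<open>m\<close> to the largest point, which the prefix fixes, so \<open>m\<close> is the preimage
  of that point. Cancelling the block reduces the claim to the prefixes.\<close>

lemma canon_perm_inj:
  "c \<in> canon l \<Longrightarrow> c' \<in> canon l \<Longrightarrow> perm_of_word c = perm_of_word c' \<Longrightarrow> c = c'"
proof (induction l arbitrary: c c')
  case (Suc l)
  let ?r = "\<lambda>m. rev [m..<Suc (Suc l)]"
  from Suc.prems obtain b m b' m' where
    c: "c = b @ ?r m" "b \<in> canon l" "m \<in> {1..Suc (Suc l)}" and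
    c': "c' = b' @ ?r m'" "b' \<in> canon l" "m' \<in> {1..Suc (Suc l)}" by (auto simp del: upt_Suc)
  have top: "perm_of_word (e @ ?r k) k = Suc (Suc l)" if "e \<in> canon l" "k \<in> {1..Suc (Suc l)}" for e k
    using that perm_of_word_rev_upt[of k "Suc (Suc l)"] perm_of_word_fixes_greater[OF canon_letters[OF that(1)]]
    by (simp add: perm_of_word_append del: upt_Suc)
  have "perm_of_word c permutes {1..Suc (Suc l)}"
    using canon_letters[OF Suc.prems(1)] perm_of_word_permutes by blast
  then have "m = m'"
    using top[OF c(2,3)] top[OF c'(2,3)] Suc.prems(3) unfolding c(1) c'(1)
    by (metis permutes_inj injD)
  moreover have "perm_of_word b = perm_of_word b'"
  proof -
    have "perm_of_word (?r m) permutes {1..Suc (Suc l)}"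
      using c(3) by (intro perm_of_word_permutes) auto
    then have "surj (perm_of_word (?r m))" by (rule permutes_surj)
    show ?thesis
    proof
      fix x
      obtain y where "x = perm_of_word (?r m) y" using \<open>surj (perm_of_word (?r m))\<close> by (rule surjE)
      then show "perm_of_word b x = perm_of_word b' x"
        using fun_cong[OF Suc.prems(3), of y] \<open>m = m'\<close>
        by (simp add: c(1) c'(1) perm_of_word_append del: upt_Suc)
    qed
  qed
  ultimately show ?case using Suc.IH[OF c(2) c'(2)] c(1) c'(1) by simp
qed simp

lemma canon_perm_surj:
  "w permutes {1..Suc l} \<Longrightarrow> \<exists>c\<in>canon l. perm_of_word c = w"
proof (induction l arbitrary: w)
  case 0
  then show ?case by simp
next
  case (Suc l)
  let ?r = "\<lambda>m. rev [m..<Suc (Suc l)]"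
  \<comment> \<open>A forced choice: \<open>m\<close> has to be the preimage of the top point.
    Dividing by the block on the right leaves a permutation fixing that point, hence one of the
    smaller symmetric group.\<close>
  define m where "m = inv w (Suc (Suc l))"
  have m: "m \<in> {1..Suc (Suc l)}"
    unfolding m_def using Suc.prems permutes_in_image[OF permutes_inv[OF Suc.prems]] by auto
  have r: "perm_of_word (?r m) permutes {1..Suc (Suc l)}"
    using m by (intro perm_of_word_permutes) auto
  define v where "v = w \<circ> inv (perm_of_word (?r m))"
  have v: "v permutes {1..Suc (Suc l)}"
    unfolding v_def by (intro permutes_compose permutes_inv r Suc.prems)
  have "inv (perm_of_word (?r m)) (Suc (Suc l)) = m"
    using r m perm_of_word_rev_upt[of m "Suc (Suc l)"] permutes_inverses(2)[OF r, of m] by auto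
  then have "v (Suc (Suc l)) = Suc (Suc l)"
    unfolding v_def m_def using permutes_inverses(1)[OF Suc.prems] by simp
  then have "v permutes {1..Suc l}"
    using permutes_superset[OF v, of "{1..Suc l}"] by (metis DiffE atLeastAtMost_iff le_Suc_eq)
  from Suc.IH[OF this] obtain b where b: "b \<in> canon l" "perm_of_word b = v" by blast
  have "perm_of_word (b @ ?r m) = w"
    unfolding perm_of_word_append b(2) v_def using permutes_inv_o(2)[OF r] by (simp only: comp_assoc comp_id)
  moreover have "b @ ?r m \<in> canon (Suc l)" using b(1) m by auto
  ultimately show ?case by blast
qed

text \<open>\<open>red_word\<close> is a \<open>SOME\<close> term, so a witness is required: the
  canonical word shows that some word represents \<open>w\<close>, and one of minimal length is
  reduced.\<close>

lemma red_word_is_reduced: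
  assumes "w permutes {1..Suc l}"
  shows "is_reduced_word (Suc l) w (red_word (Suc l) w)"
proof -
  let ?P = "\<lambda>u. set u \<subseteq> {1..<Suc l} \<and> perm_of_word u = w"
  obtain c where "c \<in> canon l" "perm_of_word c = w" using canon_perm_surj[OF assms] by blast
  then have "?P c" using canon_letters[of c l] by auto
  then have "is_reduced_word (Suc l) w (arg_min length ?P)"
    unfolding is_reduced_word_def using arg_min_nat_lemma[of ?P c length] by blast
  then show ?thesis unfolding red_word_def by (rule someI)
qed

text \<open>A square is the identity in the group but zero in the algebra: deleting it keeps the
  permutation and shortens the word by two.\<close>

lemma reduced_word_not_square:
  assumes "is_reduced_word (Suc l) w u"
  shows "\<not> has_square l u"
proof
  assume "has_square l u"
  then obtain p i q where i: "i \<in> {1..l}" and b: "beq l u (p @ [i, i] @ q)"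
    unfolding has_square_def by blast
  have "set (p @ q) \<subseteq> {1..<Suc l}" "perm_of_word (p @ q) = w" "length (p @ q) < length u"
    using assms beq_set[OF b] perm_of_word_beq[OF b] beq_length[OF b] perm_of_word_square[of p i q]
    unfolding is_reduced_word_def by auto
  then show False using assms unfolding is_reduced_word_def by (metis not_le)
qed

lemma red_word_canon:
  assumes "w permutes {1..Suc l}"
  shows "\<exists>c\<in>canon l. beq l (red_word (Suc l) w) c \<and> perm_of_word c = w"
proof -
  note r = red_word_is_reduced[OF assms]
  have "set (red_word (Suc l) w) \<subseteq> {1..l}" "perm_of_word (red_word (Suc l) w) = w"
    using r unfolding is_reduced_word_def by auto
  with word_canon reduced_word_not_square[OF r] perm_of_word_beq show ?thesis by metis
qed

lemma red_word_letters:
  "w permutes {1..Suc l} \<Longrightarrow> set (red_word (Suc l) w) \<subseteq> {1..l}"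
  using red_word_is_reduced[of w l] unfolding is_reduced_word_def by (auto simp: subset_iff)

text \<open>The form of Matsumoto's theorem that makes $T_w$ well defined.\<close>

lemma word_red_word:
  assumes "set u \<subseteq> {1..l}"
  shows "has_square l u \<or> beq l u (red_word (Suc l) (perm_of_word u))"
proof -
  obtain c where c: "c \<in> canon l" "beq l (red_word (Suc l) (perm_of_word u)) c"
      "perm_of_word c = perm_of_word u"
    using red_word_canon[OF perm_of_word_permutes[OF assms]] by blast
  \<comment> \<open>Unless \<open>u\<close> has a square, \<open>u\<close> and the reduced word are
    braid equivalent to canonical words of the same permutation, and \<open>canon_perm_inj\<close>
    identifies these.\<close>
  show ?thesis using word_canon[OF assms] c canon_perm_inj perm_of_word_beq
    by (metis beq.symI beq.transI)
qed

section \<open>Ideals of the free algebra\<close>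

text \<open>Together with \<open>fmul_mon_left_zero\<close> this describes left multiplication by a
  word as transport of coefficients along an injection of words, the form that
  \<open>pairing_pushforward\<close> consumes.\<close>

lemma fmul_mon_left: "fmul (mon u) f (u @ w) = f w"
proof -
  have "fmul (mon u) f (u @ w) = (\<Sum>i\<le>length (u @ w). if i = length u then f w else 0)"
    unfolding fmul_def mon_def
  proof (intro sum.cong refl)
    fix i assume "i \<in> {..length (u @ w)}"
    then have "length (take i (u @ w)) = i" by simp
    then have "take i (u @ w) = u \<longleftrightarrow> i = length u" by (metis append_eq_conv_conj)
    then show "(if take i (u @ w) = u then 1 else 0) * f (drop i (u @ w))
        = (if i = length u then f w else 0)" by simp
  qed
  then show ?thesis by simp
qed

lemma fmul_mon_left_zero: "v \<notin> range ((@) u) \<Longrightarrow> fmul (mon u) f v = 0"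
proof -
  assume "v \<notin> range ((@) u)"
  then have "take i v \<noteq> u" for i by (metis append_take_drop_id rangeI)
  then show ?thesis by (simp add: fmul_def mon_def)
qed

lemma fmul_mon_right: "fmul f (mon u) (w @ u) = f w"
proof -
  have "fmul f (mon u) (w @ u) = (\<Sum>i\<le>length (w @ u). if i = length w then f w else 0)"
    unfolding fmul_def mon_def
  proof (intro sum.cong refl)
    fix i assume "i \<in> {..length (w @ u)}"
    then have "drop i (w @ u) = u \<longleftrightarrow> i = length w"
      by (metis add_diff_cancel_right' append_eq_conv_conj append_take_drop_id atMost_iff diff_diff_cancel length_append length_drop)
    then show "f (take i (w @ u)) * (if drop i (w @ u) = u then 1 else 0)
        = (if i = length w then f w else 0)" by simp
  qed
  then show ?thesis by simp
qed

lemma fmul_mon_right_zero: "v \<notin> range (\<lambda>w. w @ u) \<Longrightarrow> fmul f (mon u) v = 0"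
proof -
  assume "v \<notin> range (\<lambda>w. w @ u)"
  then have "drop i v \<noteq> u" for i by (metis (mono_tags, lifting) append_take_drop_id rangeI)
  then show ?thesis by (simp add: fmul_def mon_def)
qed

lemma fmul_mon_mon: "fmul (mon u) (mon v) = (mon (u @ v) :: 'k::comm_ring_1 fa)"
proof
  fix w show "fmul (mon u) (mon v) w = (mon (u @ v) w :: 'k)"
  proof (cases "w \<in> range ((@) u)")
    case True
    then show ?thesis by (auto simp: fmul_mon_left) (simp add: mon_def)
  next
    case False
    then have "w \<noteq> u @ v" by blast
    then show ?thesis using fmul_mon_left_zero[OF False] by (simp add: mon_def)
  qed
qed

lemma fmul_fsub_left: "fmul (fsub f g) h = fsub (fmul f h) (fmul g h)"
  by (simp add: fmul_def fsub_def left_diff_distrib sum_subtractf)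

lemma fmul_fsub_right: "fmul h (fsub f g) = fsub (fmul h f) (fmul h g)"
  by (simp add: fmul_def fsub_def right_diff_distrib sum_subtractf)

lemma gen_ideal_uminus: "f \<in> gen_ideal L R \<Longrightarrow> (\<lambda>w. - f w) \<in> gen_ideal L R"
  using gen_ideal.smul[of f L R "-1"] by (simp add: fsmul_def)

lemma gen_ideal_fsub: "f \<in> gen_ideal L R \<Longrightarrow> g \<in> gen_ideal L R \<Longrightarrow> fsub f g \<in> gen_ideal L R"
  using gen_ideal.add[OF _ gen_ideal_uminus, of f L R g] by (simp add: fadd_def fsub_def)

lemma gen_ideal_mono: "f \<in> gen_ideal L R \<Longrightarrow> L \<subseteq> L' \<Longrightarrow> R \<subseteq> R' \<Longrightarrow> f \<in> gen_ideal L' R'"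
  by (induction rule: gen_ideal.induct) (auto intro: gen_ideal.intros)

lemma gen_ideal_context:
  assumes "f \<in> gen_ideal L R" "set p \<subseteq> L" "set q \<subseteq> L"
  shows "fmul (mon p) (fmul f (mon q)) \<in> gen_ideal L R"
  using assms by (intro gen_ideal.lmul gen_ideal.rmul)

lemma gen_ideal_mon_context:
  assumes "mon u \<in> gen_ideal L R" "set p \<subseteq> L" "set q \<subseteq> L"
  shows "mon (p @ u @ q) \<in> gen_ideal L R"
  using gen_ideal_context[OF assms] by (simp add: fmul_mon_mon)

lemma gen_ideal_mon_diff_context:
  assumes "fsub (mon u) (mon v) \<in> gen_ideal L R" "set p \<subseteq> L" "set q \<subseteq> L"
  shows "fsub (mon (p @ u @ q)) (mon (p @ v @ q)) \<in> gen_ideal L R"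
  using gen_ideal_context[OF assms] by (simp add: fmul_mon_mon fmul_fsub_left fmul_fsub_right)

text \<open>\<open>beq\<close> admits arbitrary contexts, while the ideal is closed only under
  multiplication by words over \<open>{1..l}\<close>; hence the hypothesis on \<open>u\<close>,
  which \<open>beq_set\<close> propagates along the chain.\<close>

lemma beq_gen_ideal:
  assumes "beq l u v" "set u \<subseteq> {1..l}" "braid_rels l \<subseteq> R"
  shows "fsub (mon u) (mon v) \<in> gen_ideal {1..l} R"
  using assms(1,2)
proof (induction rule: beq.induct)
  case (reflI u)
  then show ?case using gen_ideal.zero by (simp add: fsub_def)
next
  case (symI u v)
  then have "fsub (mon u) (mon v) \<in> gen_ideal {1..l} R" using beq_set by blast
  from gen_ideal_uminus[OF this] show ?case by (simp add: fsub_def)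
next
  case (transI u v w)
  then have "fsub (mon u) (mon v) \<in> gen_ideal {1..l} R" "fsub (mon v) (mon w) \<in> gen_ideal {1..l} R"
    using beq_set by blast+
  from gen_ideal.add[OF this] show ?case by (simp add: fadd_def fsub_def)
next
  case (braid i p q)
  then have "fsub (mon [i, Suc i, i]) (mon [Suc i, i, Suc i]) \<in> R"
    using assms(3) unfolding braid_rels_def by blast
  then show ?case using braid.prems by (intro gen_ideal_mon_diff_context gen_ideal.gen) auto
next
  case (comm i j p q)
  then have "fsub (mon [i, j]) (mon [j, i]) \<in> R"
    using assms(3) unfolding braid_rels_def by blast
  then show ?case using comm.prems by (intro gen_ideal_mon_diff_context gen_ideal.gen) auto
qed

lemma mon_gen_ideal_beq:
  assumes "beq l u v" "set u \<subseteq> {1..l}" "braid_rels l \<subseteq> R" "mon v \<in> gen_ideal {1..l} R"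
  shows "mon u \<in> gen_ideal {1..l} R"
  using gen_ideal.add[OF beq_gen_ideal[OF assms(1-3)] assms(4)] by (simp add: fadd_def fsub_def)

text \<open>Kept general in \<open>R\<close> and \<open>b\<close> because it is applied twice: to
  the claimed basis, and to the reduced words of S_{l+1} in the nil-Coxeter algebra.\<close>

lemma span_of_words:
  fixes f :: "'k::comm_ring_1 fa"
  assumes "finite B"
    and words: "\<And>u. set u \<subseteq> L \<Longrightarrow>
      mon u \<in> gen_ideal L R \<or> (\<exists>j\<in>B. fsub (mon u) (mon (b j)) \<in> gen_ideal L R)"
    and f: "in_FA L f"
  shows "\<exists>c. fsub f (\<lambda>u. \<Sum>j\<in>B. c j * mon (b j) u) \<in> gen_ideal L R"
proof -
  let ?in_span = "\<lambda>f. \<exists>c. fsub f (\<lambda>u. \<Sum>j\<in>B. c j * mon (b j) u) \<in> gen_ideal L R"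
  have word: "?in_span (fsmul a (mon u))" if "set u \<subseteq> L" for a u
    using words[OF that]
  proof
    assume "mon u \<in> gen_ideal L R"
    then show ?thesis using gen_ideal.smul[of "mon u" L R a]
      by (intro exI[of _ "\<lambda>_. 0"]) (simp add: fsub_def)
  next
    assume "\<exists>j\<in>B. fsub (mon u) (mon (b j)) \<in> gen_ideal L R"
    then obtain j where j: "j \<in> B" "fsub (mon u) (mon (b j)) \<in> gen_ideal L R" by blast
    let ?c = "\<lambda>i. if i = j then a else 0"
    have "(\<Sum>i\<in>B. ?c i * mon (b i) v) = a * mon (b j) v" for v
      using j(1) assms(1) by (simp add: if_distrib[of "\<lambda>x. x * _"] cong: if_cong)
    then show ?thesis using gen_ideal.smul[OF j(2), of a]
      by (intro exI[of _ ?c]) (simp add: fsub_def fsmul_def right_diff_distrib)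
  qed
  have add: "?in_span (fadd g h)" if g: "?in_span g" and h: "?in_span h" for g h
  proof -
    from g h obtain c c' where
      "fsub g (\<lambda>u. \<Sum>j\<in>B. c j * mon (b j) u) \<in> gen_ideal L R"
      "fsub h (\<lambda>u. \<Sum>j\<in>B. c' j * mon (b j) u) \<in> gen_ideal L R" by blast
    from gen_ideal.add[OF this] show ?thesis
      by (intro exI[of _ "\<lambda>j. c j + c' j"])
        (simp add: fsub_def fadd_def distrib_right sum.distrib algebra_simps)
  qed
  have "finite S \<Longrightarrow> (\<And>u. u \<in> S \<Longrightarrow> set u \<subseteq> L) \<Longrightarrow> ?in_span (\<lambda>w. if w \<in> S then f w else 0)" for S
  proof (induction S rule: finite_induct)
    case empty
    then show ?case using gen_ideal.zero by (intro exI[of _ "\<lambda>_. 0"]) (simp add: fsub_def)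
  next
    case (insert u S)
    have "(\<lambda>w. if w \<in> insert u S then f w else 0)
        = fadd (fsmul (f u) (mon u)) (\<lambda>w. if w \<in> S then f w else 0)"
      using insert.hyps by (auto simp: fadd_def fsmul_def mon_def)
    then show ?case using insert add[OF word] by simp
  qed
  from this[of "{w. f w \<noteq> 0}"] have "?in_span (\<lambda>w. if w \<in> {w. f w \<noteq> 0} then f w else 0)"
    using f unfolding in_FA_def fsupp_def by blast
  moreover have "(\<lambda>w. if w \<in> {w. f w \<noteq> 0} then f w else 0) = f" by auto
  ultimately show ?thesis by simp
qed

section \<open>Partial right actions and functionals vanishing on an ideal\<close>

primrec run :: "('s \<Rightarrow> nat \<Rightarrow> 's option) \<Rightarrow> 's \<Rightarrow> nat list \<Rightarrow> 's option" where
  "run a s [] = Some s"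
| "run a s (i # u) = Option.bind (a s i) (\<lambda>t. run a t u)"

lemma run_append: "run a s (u @ v) = Option.bind (run a s u) (\<lambda>t. run a t v)"
  by (induction u arbitrary: s) (simp_all add: bind_assoc)

text \<open>The linear extension of \<open>F\<close> from words to the free algebra. It is
  meaningful for finite support only, so \<open>fsupp\<close> has to travel along in the induction
  over the ideal.\<close>

definition pairing :: "(nat list \<Rightarrow> 'k::comm_ring_1) \<Rightarrow> 'k fa \<Rightarrow> 'k" where
  "pairing F f = (\<Sum>w | f w \<noteq> 0. f w * F w)"

lemma pairing_superset:
  "finite S \<Longrightarrow> {w. f w \<noteq> 0} \<subseteq> S \<Longrightarrow> pairing F f = (\<Sum>w\<in>S. f w * F w)"
  unfolding pairing_def by (intro sum.mono_neutral_left) auto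

lemma pairing_mon: "pairing F (mon u) = F u"
  by (subst pairing_superset[of "{u}"]) (auto simp: mon_def)

lemma pairing_fsub:
  assumes "fsupp f" "fsupp g"
  shows "pairing F (fsub f g) = pairing F f - pairing F g"
proof -
  let ?S = "{w. f w \<noteq> 0} \<union> {w. g w \<noteq> 0}"
  have S: "finite ?S" using assms by (simp add: fsupp_def)
  show ?thesis
    by (subst (1 2 3) pairing_superset[OF S])
      (auto simp: fsub_def left_diff_distrib sum_subtractf)
qed

lemma fsupp_mon: "fsupp (mon u :: 'k::comm_ring_1 fa)"
  unfolding fsupp_def by (rule finite_subset[of _ "{u}"]) (auto simp: mon_def)

lemma fsupp_fsub: "fsupp f \<Longrightarrow> fsupp g \<Longrightarrow> fsupp (fsub f g :: 'k::comm_ring_1 fa)"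
  unfolding fsupp_def
  by (rule finite_subset[of _ "{w. f w \<noteq> 0} \<union> {w. g w \<noteq> 0}"]) (auto simp: fsub_def)

lemma pairing_pushforward:
  assumes "fsupp f" "inj h" "\<And>w. g (h w) = f w" "\<And>v. v \<notin> range h \<Longrightarrow> g v = 0"
  shows "fsupp g" "pairing F g = pairing (\<lambda>w. F (h w)) f"
proof -
  have supp: "{v. g v \<noteq> 0} = h ` {w. f w \<noteq> 0}"
    using assms(3,4) by (auto simp: image_iff) (metis rangeE)
  then show "fsupp g" using assms(1) by (simp add: fsupp_def)
  show "pairing F g = pairing (\<lambda>w. F (h w)) f"
    unfolding pairing_def supp using assms(2,3)
    by (subst sum.reindex) (auto simp: inj_on_def inj_def)
qed

text \<open>The words \<open>b j\<close> may coincide, so the support is bounded by the image of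
  \<open>J\<close> and the two sums are exchanged instead of reindexed.\<close>

lemma pairing_sum_mon:
  assumes J: "finite J"
  shows "pairing F (\<lambda>u. \<Sum>j\<in>J. c j * mon (b j) u) = (\<Sum>j\<in>J. c j * F (b j))"
proof -
  have "{w. (\<Sum>j\<in>J. c j * mon (b j) w) \<noteq> 0} \<subseteq> b ` J"
  proof
    fix w assume "w \<in> {w. (\<Sum>j\<in>J. c j * mon (b j) w) \<noteq> 0}"
    then obtain j where "j \<in> J" "c j * mon (b j) w \<noteq> 0"
      by (metis (mono_tags, lifting) mem_Collect_eq sum.neutral)
    then show "w \<in> b ` J" by (auto simp: mon_def split: if_splits)
  qed
  then have "pairing F (\<lambda>u. \<Sum>j\<in>J. c j * mon (b j) u)
      = (\<Sum>w\<in>b ` J. (\<Sum>j\<in>J. c j * mon (b j) w) * F w)"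
    using J by (intro pairing_superset) auto
  also have "\<dots> = (\<Sum>j\<in>J. \<Sum>w\<in>b ` J. c j * mon (b j) w * F w)"
    unfolding sum_distrib_right by (rule sum.swap)
  also have "\<dots> = (\<Sum>j\<in>J. c j * F (b j))"
  proof (intro sum.cong refl)
    fix j assume "j \<in> J"
    have "(\<Sum>w\<in>b ` J. c j * mon (b j) w * F w) = (\<Sum>w\<in>b ` J. if w = b j then c j * F w else 0)"
      by (intro sum.cong) (auto simp: mon_def)
    then show "(\<Sum>w\<in>b ` J. c j * mon (b j) w * F w) = c j * F (b j)"
      using J \<open>j \<in> J\<close> by simp
  qed
  finally show ?thesis .
qed

lemma run_closed:
  assumes "\<forall>s\<in>X. \<forall>i\<in>L. \<forall>t. a s i = Some t \<longrightarrow> t \<in> X"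
  shows "s \<in> X \<Longrightarrow> set u \<subseteq> L \<Longrightarrow> run a s u = Some t \<Longrightarrow> t \<in> X"
proof (induction u arbitrary: s)
  case (Cons i u)
  then obtain r where "a s i = Some r" "run a r u = Some t" by (auto simp: bind_eq_Some_conv)
  moreover from this have "r \<in> X" using Cons.prems assms by auto
  ultimately show ?case using Cons by simp
qed simp

text \<open>Quantifying over all functionals of the final state, rather than over final states,
  is what makes the induction go through for right multiplication.\<close>

lemma gen_ideal_pairing_zero:
  fixes f :: "'k::comm_ring_1 fa"
  assumes "f \<in> gen_ideal L R"
    and closed: "\<forall>s\<in>X. \<forall>i\<in>L. \<forall>t. a s i = Some t \<longrightarrow> t \<in> X"
    and supp: "\<And>r. r \<in> R \<Longrightarrow> fsupp r"
    and rels: "\<And>r s F. r \<in> R \<Longrightarrow> s \<in> X \<Longrightarrow> F None = 0 \<Longrightarrow> pairing (\<lambda>w. F (run a s w)) r = 0"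
  shows "fsupp f \<and> (\<forall>s\<in>X. \<forall>F. F None = 0 \<longrightarrow> pairing (\<lambda>w. F (run a s w)) f = 0)"
  using assms(1)
proof (induction rule: gen_ideal.induct)
  case (gen r)
  then show ?case using supp rels by blast
next
  case zero
  then show ?case by (simp add: fsupp_def pairing_def)
next
  case (add x y)
  let ?S = "{w. x w \<noteq> 0} \<union> {w. y w \<noteq> 0}"
  have S: "finite ?S" using add by (simp add: fsupp_def)
  have sub: "{w. fadd x y w \<noteq> 0} \<subseteq> ?S" by (auto simp: fadd_def)
  have "pairing F (fadd x y) = pairing F x + pairing F y" for F
    by (subst (1 2 3) pairing_superset[OF S]) (use sub in \<open>auto simp: fadd_def distrib_right sum.distrib\<close>)
  moreover have "fsupp (fadd x y)" unfolding fsupp_def by (rule finite_subset[OF sub S])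
  ultimately show ?case using add by simp
next
  case (smul x c)
  have S: "finite {w. x w \<noteq> 0}" using smul by (simp add: fsupp_def)
  have sub: "{w. fsmul c x w \<noteq> 0} \<subseteq> {w. x w \<noteq> 0}" by (auto simp: fsmul_def)
  have "pairing F (fsmul c x) = c * pairing F x" for F
    by (subst (1 2) pairing_superset[OF S]) (use sub in \<open>auto simp: fsmul_def sum_distrib_left mult.assoc\<close>)
  moreover have "fsupp (fsmul c x)" unfolding fsupp_def by (rule finite_subset[OF sub S])
  ultimately show ?case using smul by simp
next
  case (lmul x u)
  note push = pairing_pushforward[of x "(@) u" "fmul (mon u) x", OF _ _ fmul_mon_left fmul_mon_left_zero]
  have "pairing (\<lambda>w. F (run a s w)) (fmul (mon u) x) = 0" if s: "s \<in> X" and F: "F None = 0" for s F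
  \<comment> \<open>A left factor changes the starting state: if it survives, the induction
    hypothesis is used at the new state \<open>t\<close>; if not, every term contains
    \<open>F None = 0\<close>.\<close>
  proof (cases "run a s u")
    case None
    then have "pairing (\<lambda>w. F (run a s (u @ w))) x = 0"
      by (simp add: run_append F pairing_def)
    then show ?thesis using lmul.IH by (subst push(2)) (simp_all add: inj_def)
  next
    case (Some t)
    then have "t \<in> X" using run_closed[OF closed s] lmul.hyps by blast
    then have "pairing (\<lambda>w. F (run a s (u @ w))) x = 0"
      using lmul.IH F by (simp add: run_append Some)
    then show ?thesis using lmul.IH by (subst push(2)) (simp_all add: inj_def)
  qed
  moreover have "fsupp (fmul (mon u) x)" using push(1) lmul by (simp add: inj_def)
  ultimately show ?case by blast
next
  case (rmul x u)
  note push = pairing_pushforward[of x "\<lambda>w. w @ u" "fmul x (mon u)", OF _ _ fmul_mon_right fmul_mon_right_zero]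
  have "pairing (\<lambda>w. F (run a s w)) (fmul x (mon u)) = 0" if s: "s \<in> X" and F: "F None = 0" for s F
  proof -
    let ?G = "\<lambda>z. F (Option.bind z (\<lambda>t. run a t u))"
    have "pairing (\<lambda>w. ?G (run a s w)) x = 0"
      using rmul.IH[THEN conjunct2, rule_format, OF s, of ?G] F by simp
    then have "pairing (\<lambda>w. F (run a s (w @ u))) x = 0"
      by (simp only: run_append)
    then show ?thesis using rmul.IH by (subst push(2)) (simp_all add: inj_def)
  qed
  moreover have "fsupp (fmul x (mon u))" using push(1) rmul by (simp add: inj_def)
  ultimately show ?case by blast
qed

section \<open>The action on basis indices\<close>

text \<open>The product T_w T_i in the nil-Coxeter algebra: \<open>w i < w (Suc i)\<close> says that
  right multiplication by the transposition creates an inversion, that is, increases the length;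
  otherwise the product is zero.\<close>

definition nil_act :: "(nat \<Rightarrow> nat) \<Rightarrow> nat \<Rightarrow> (nat \<Rightarrow> nat) option" where
  "nil_act w i = (if w i < w (Suc i) then Some (w \<circ> transpose i (Suc i)) else None)"

lemma nil_act_square: "Option.bind (nil_act w i) (\<lambda>v. nil_act v i) = None"
  by (simp add: nil_act_def)

lemma nil_act_comm:
  "i + 1 < j \<Longrightarrow> Option.bind (nil_act w i) (\<lambda>v. nil_act v j) = Option.bind (nil_act w j) (\<lambda>v. nil_act v i)"
  by (auto simp: nil_act_def transpose_def fun_eq_iff)

lemma nil_act_braid:
  "Option.bind (nil_act w i) (\<lambda>v. Option.bind (nil_act v (Suc i)) (\<lambda>u. nil_act u i))
   = Option.bind (nil_act w (Suc i)) (\<lambda>v. Option.bind (nil_act v i) (\<lambda>u. nil_act u (Suc i)))"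
  by (auto simp: nil_act_def transpose_def fun_eq_iff)

type_synonym index = "(nat \<Rightarrow> nat) \<times> (nat \<times> nat) option"

text \<open>Right multiplication by $T_i$ on the claimed basis, with None as the zero element.\<close>

fun act :: "nat \<Rightarrow> nat \<Rightarrow> index \<Rightarrow> nat \<Rightarrow> index option" where
  "act n d (w, None) i =
     (if i < n then map_option (\<lambda>v. (v, None)) (nil_act w i) else Some (w, Some (1, n)))"
| "act n d (w, Some (k, m)) i =
     (if i = n \<and> m = n then (if Suc k < d then Some (w, Some (Suc k, n)) else None)
      else if i = n \<and> k \<noteq> 1 then None
      else if Suc i < m then map_option (\<lambda>v. (v, Some (k, m))) (nil_act w i)
      else if Suc i = m then Some (w, Some (k, i))
      else if i = m then None
      else map_option (\<lambda>v. (v, Some (k, m))) (nil_act w (i - 1)))"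

lemma nil_act_permutes:
  "w permutes {1..n} \<Longrightarrow> i \<in> {1..<n} \<Longrightarrow> nil_act w i = Some v \<Longrightarrow> v permutes {1..n}"
  by (auto simp: nil_act_def split: if_splits intro!: permutes_compose permutes_swap_id)

lemma basis_index_None: "(w, None) \<in> basis_index n d \<longleftrightarrow> w permutes {1..n}"
  by (auto simp: basis_index_def)

lemma basis_index_Some:
  "(w, Some (k, m)) \<in> basis_index n d \<longleftrightarrow> w permutes {1..n} \<and> k \<in> {1..d-1} \<and> m \<in> {1..n}"
  by (auto simp: basis_index_def)

lemma act_closed:
  assumes "d \<ge> 2"
  shows "\<forall>s\<in>basis_index n d. \<forall>i\<in>{1..n}. \<forall>t. act n d s i = Some t \<longrightarrow> t \<in> basis_index n d"
proof (intro ballI allI impI)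
  fix s i t
  assume *: "s \<in> basis_index n d" "i \<in> {1..n}" "act n d s i = Some t"
  show "t \<in> basis_index n d"
  proof (cases "(n, d, s, i)" rule: act.cases)
    case (1 n' d' w j)
    then show ?thesis using assms * nil_act_permutes[of w n i]
      by (auto simp: basis_index_None basis_index_Some split: if_splits)
  next
    case (2 n' d' w k m j)
    have "v permutes {1..n}" if "m < i" "nil_act w (i - 1) = Some v" for v
    proof (rule nil_act_permutes[OF _ _ that(2)])
      show "w permutes {1..n}" using 2 * by (auto simp: basis_index_Some)
      \<comment> \<open>The letter that reaches \<open>w\<close> is \<open>i - 1\<close>: it is at
        least 1 because \<open>1 \<le> m\<close> and \<open>m < i\<close>, and it is below
        \<open>n\<close> even for \<open>i = n\<close>.\<close>
      have "1 \<le> m" using 2 * by (auto simp: basis_index_Some)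
      then show "i - 1 \<in> {1..<n}" using *(2) that(1) by auto
    qed
    then show ?thesis using 2 assms * nil_act_permutes[of w n i]
      by (auto simp: basis_index_None basis_index_Some split: if_splits)
  qed
qed

section \<open>The defining relations hold for the action\<close>

lemma act_square:
  assumes "s \<in> basis_index n d" "i \<in> {1..<n}"
  shows "run (act n d) s [i, i] = None"
proof (cases "(n, d, s, i)" rule: act.cases)
  case (1 n' d' w j)
  then show ?thesis using assms nil_act_square[of w i]
    by (cases "nil_act w i") auto
next
  case (2 n' d' w k m j)
  then show ?thesis using assms nil_act_square[of w i] nil_act_square[of w "i - 1"]
    by (cases "nil_act w i"; cases "nil_act w (i - 1)") (auto simp: basis_index_Some)
qed

text \<open>As long as the second component of an index stays fixed, only the permutation changes,
  by a letter relabelled through \<open>h\<close> (unchanged, or lowered by one after passing the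
  tail). The relations of \<open>act\<close> then reduce to those of \<open>nil_act\<close>.\<close>

lemma run_lift:
  assumes "\<And>v i. i \<in> set u \<Longrightarrow> a (G v) i = map_option G (a' v (h i))"
  shows "run a (G w) u = map_option G (run a' w (map h u))"
  using assms
proof (induction u arbitrary: w)
  case (Cons i u)
  then show ?case by (cases "a' w (h i)") auto
qed simp

lemma act_comm:
  assumes "s \<in> basis_index n d" "i \<in> {1..n}" "j \<in> {1..n}" "i + 1 < j"
  shows "run (act n d) s [i, j] = run (act n d) s [j, i]"
proof -
  obtain w z where s: "s = (w, z)" by (cases s)
  have nil_comm: "run nil_act w [i', j'] = run nil_act w [j', i']" if "i' + 1 < j'" for i' j'
    using nil_act_comm[OF that, of w] by simp
  show ?thesis
  proof (cases z)
    case None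
    then show ?thesis using s assms nil_act_comm[of i j w]
      by (cases "nil_act w i"; cases "nil_act w j") auto
  next
    case (Some p)
    obtain k m where p: "p = (k, m)" by (cases p)
    have m: "1 \<le> m" "m \<le> n" using s Some p assms by (auto simp: basis_index_Some)
    let ?G = "\<lambda>v. (v, Some (k, m))"
    have s: "s = ?G w" using s Some p by simp
    show ?thesis
    proof (cases "j = n \<and> m < n \<and> k \<noteq> 1")
      case True
      \<comment> \<open>Here \<open>j = n\<close> annihilates. The claim is made for every
        \<open>m' < n\<close> because acting with \<open>i\<close> first may lower \<open>m\<close>
        to \<open>i\<close>.\<close>
      then have "act n d (v, Some (k, m')) j = None" if "m' < n" for v m' using that by simp
      moreover have "Option.bind (act n d s i) (\<lambda>t. act n d t j) = None"
        using True assms by (cases "nil_act w i"; cases "nil_act w (i - 1)") (simp_all add: s)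
      ultimately show ?thesis using True by (simp add: s)
    next
      case False
      have lift: ?thesis
        if h: "h i + 1 < h j" "\<And>v x. x \<in> {i, j} \<Longrightarrow> act n d (?G v) x = map_option ?G (nil_act v (h x))" for h
      proof -
        have "run (act n d) (?G w) u = map_option ?G (run nil_act w (map h u))" if "set u \<subseteq> {i, j}" for u
          using that by (intro run_lift h(2)) auto
        from this[of "[i, j]"] this[of "[j, i]"] show ?thesis
          using nil_comm[OF h(1)] unfolding s by (simp del: run.simps)
      qed
      consider "Suc j < m" | "Suc j = m" | "j = m" | "m < j" "Suc i < m" | "m < j" "Suc i = m"
        | "m < j" "i = m" | "m < i" by linarith
      then show ?thesis
      proof cases
        case 1
        then show ?thesis using assms m by (intro lift[of id]) auto
      next
        case 2
        then show ?thesis using assms m by (cases "nil_act w i") (auto simp: s)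
      next
        case 3
        then show ?thesis using assms by (cases "nil_act w i") (auto simp: s)
      next
        case 4
        \<comment> \<open>The tail separates the letters, so only \<open>j\<close> is shifted;
          \<open>i + 1 < m\<close> and \<open>m \<le> j - 1\<close> keep them far apart.\<close>
        then show ?thesis using assms m False by (intro lift[of "\<lambda>x. if x = i then i else j - 1"]) auto
      next
        case 5
        then show ?thesis using assms m False by (cases "nil_act w (j - 1)") (auto simp: s)
      next
        case 6
        then show ?thesis using assms False by (cases "nil_act w (j - 1)") (auto simp: s)
      next
        case 7
        then show ?thesis using assms m False by (intro lift[of "\<lambda>x. x - 1"]) auto
      qed
    qed
  qed
qed

lemma act_braid:
  assumes "s \<in> basis_index n d" "0 < i" "i < n"
  shows "run (act n d) s [i, Suc i, i] = run (act n d) s [Suc i, i, Suc i]"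
proof -
  obtain w z where s: "s = (w, z)" by (cases s)
  have nil_braid: "run nil_act w [j, Suc j, j] = run nil_act w [Suc j, j, Suc j]" for j
    using nil_act_braid[of w j] by simp
  show ?thesis
  proof (cases z)
    case None
    show ?thesis
    proof (cases "Suc i = n")
      \<comment> \<open>This case dictates the clause for \<open>k = 1\<close>: T_i T_n T_i leads to
        the tail reaching down to \<open>i\<close> over \<open>nil_act w i\<close>, and T_n T_i T_n
        has to agree.\<close>
      case True
      then show ?thesis using s None assms by (cases "nil_act w i") auto
    next
      case False
      let ?G = "\<lambda>v. (v, None)"
      have "run (act n d) (?G w) u = map_option ?G (run nil_act w (map id u))" if "set u \<subseteq> {i, Suc i}" for u
        using that False assms by (intro run_lift) auto
      from this[of "[i, Suc i, i]"] this[of "[Suc i, i, Suc i]"] show ?thesis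
        using nil_braid[of i] unfolding s None by (simp del: run.simps)
    qed
  next
    case (Some p)
    obtain k m where p: "p = (k, m)" by (cases p)
    have m: "1 \<le> m" "m \<le> n" "k \<ge> 1" using s Some p assms by (auto simp: basis_index_Some)
    let ?G = "\<lambda>v. (v, Some (k, m))"
    have s: "s = ?G w" using s Some p by simp
    consider "Suc (Suc i) < m" | "m = Suc (Suc i)" | "m = Suc i" | "i = m" | "m < i" by linarith
    then show ?thesis
    proof cases
      case 1
      have "run (act n d) (?G w) u = map_option ?G (run nil_act w (map id u))" if "set u \<subseteq> {i, Suc i}" for u
        using that 1 m assms by (intro run_lift) auto
      from this[of "[i, Suc i, i]"] this[of "[Suc i, i, Suc i]"] show ?thesis
        using nil_braid[of i] unfolding s by (simp del: run.simps)
    next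
      case 2
      \<comment> \<open>On the right the tail is first lowered to \<open>i\<close>; the last letter
        \<open>Suc i\<close> then passes it and acts on \<open>w\<close> as \<open>i\<close>, the
        letter that acts first on the left.\<close>
      then show ?thesis using m by (cases "nil_act w i") (simp_all add: s)
    next
      case 3
      show ?thesis
      \<comment> \<open>Both sides vanish. If \<open>n = Suc i\<close>, the right side does so
        because the first \<open>n\<close> gives zero or an exponent of at least 2, and after the
        letter \<open>i\<close> the second \<open>n\<close> annihilates.\<close>
      proof (cases "n = Suc i")
        case True
        then show ?thesis using m 3 by (cases "nil_act w i") (simp_all add: s)
      next
        case False
        then show ?thesis using m 3 by (cases "nil_act w i") (simp_all add: s)
      qed
    next
      case 4
      then have "act n d s i = None" using assms by (simp add: s)
      moreover have "Option.bind (act n d s (Suc i)) (\<lambda>t. act n d t i) = None"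
        using 4 assms by (cases "nil_act w i") (simp_all add: s)
      ultimately show ?thesis by (simp flip: bind_assoc)
    next
      case 5
      show ?thesis
      proof (cases "Suc i = n \<and> k \<noteq> 1")
        case True
        then have "act n d (?G v) (Suc i) = None" for v using 5 by simp
        moreover have "act n d s i = map_option ?G (nil_act w (i - 1))" using 5 assms by (simp add: s)
        ultimately show ?thesis by (cases "nil_act w (i - 1)") (simp_all add: s)
      next
        case False
        have "run (act n d) (?G w) u = map_option ?G (run nil_act w (map (\<lambda>x. x - 1) u))"
          if "set u \<subseteq> {i, Suc i}" for u
          using that False 5 m assms by (intro run_lift) auto
        from this[of "[i, Suc i, i]"] this[of "[Suc i, i, Suc i]"] show ?thesis
          using nil_braid[of "i - 1"] 5 unfolding s by (simp del: run.simps)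
      qed
    qed
  qed
qed

lemma run_replicate:
  assumes "k + j < d"
  shows "run (act n d) (w, Some (k, n)) (replicate j n) = Some (w, Some (k + j, n))"
  using assms by (induction j arbitrary: k) auto

lemma act_power:
  assumes "s \<in> basis_index n d" "d \<ge> 2"
  shows "run (act n d) s (replicate d n) = None"
proof -
  have top: "run (act n d) (w, Some (k, n)) (replicate j n) = None" if "d \<le> k + j" "k < d" for w k j
    using that by (induction j arbitrary: k) auto
  show ?thesis
  proof (cases "(n, d, s, n)" rule: act.cases)
    case (1 n' d' w i')
    then show ?thesis using assms top[of 1 "d - 1" w] by (cases d) auto
  next
    case (2 n' d' w k m i')
    show ?thesis
    proof (cases "m = n")
      case True
      then show ?thesis using 2 assms top[of k d w] by (auto simp: basis_index_Some)
    next
      case False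
      \<comment> \<open>Since \<open>d \<ge> 2\<close>, at least two letters \<open>n\<close> are
        applied. If \<open>k \<noteq> 1\<close>, the first gives zero; if \<open>k = 1\<close>, both
        act on \<open>w\<close> by \<open>n - 1\<close>, which is a square.\<close>
      obtain e where d: "d = Suc (Suc e)" using assms(2) by (metis add_2_eq_Suc le_Suc_ex)
      show ?thesis using 2 assms False nil_act_square[of w "n - 1"]
        by (cases "nil_act w (n - 1)") (auto simp: basis_index_Some d)
    qed
  qed
qed

section \<open>Functionals vanishing on the ideal and linear independence\<close>

lemma NCA_rels_fsupp: "r \<in> NCA_rels n d \<Longrightarrow> fsupp (r :: 'k::comm_ring_1 fa)"
  by (auto simp: NCA_rels_def braid_rels_def intro!: fsupp_mon fsupp_fsub)

lemma NCA_rels_pairing_zero: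
  fixes r :: "'k::comm_ring_1 fa"
  assumes "d \<ge> 2" "r \<in> NCA_rels n d" "s \<in> basis_index n d" "F None = 0"
  shows "pairing (\<lambda>w. F (run (act n d) s w)) r = 0"
proof -
  consider (braid) i where "r = fsub (mon [i, Suc i, i]) (mon [Suc i, i, Suc i])" "0 < i" "i < n"
    | (comm) i j where "r = fsub (mon [i, j]) (mon [j, i])" "i \<in> {1..n}" "j \<in> {1..n}" "i + 1 < j \<or> j + 1 < i"
    | (square) i where "r = mon [i, i]" "1 \<le> i" "i \<le> n - 1"
    | (power) "r = mon (replicate d n)"
    using assms(2) unfolding NCA_rels_def braid_rels_def by blast
  then show ?thesis
  proof cases
    case braid
    then show ?thesis using act_braid[OF assms(3), of i]
      by (simp add: pairing_fsub fsupp_mon pairing_mon del: run.simps)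
  next
    case comm
    then show ?thesis using act_comm[OF assms(3), of i j] act_comm[OF assms(3), of j i]
      by (auto simp: pairing_fsub fsupp_mon pairing_mon simp del: run.simps)
  next
    case square
    then show ?thesis using act_square[OF assms(3), of i] assms(4)
      by (simp add: pairing_mon del: run.simps)
  next
    case power
    then show ?thesis using act_power[OF assms(3,1)] assms(4) by (simp add: pairing_mon)
  qed
qed

lemma NCA_ideal_pairing_zero:
  fixes f :: "'k::comm_ring_1 fa"
  assumes "d \<ge> 2" "f \<in> NCA_ideal n d" "s \<in> basis_index n d" "F None = 0"
  shows "pairing (\<lambda>w. F (run (act n d) s w)) f = 0"
proof -
  have "fsupp f \<and> (\<forall>s\<in>basis_index n d. \<forall>F. F None = 0 \<longrightarrow> pairing (\<lambda>w. F (run (act n d) s w)) f = 0)"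
    using assms(2)[unfolded NCA_ideal_def] act_closed[OF assms(1)]
  proof (rule gen_ideal_pairing_zero)
    show "fsupp r" if "r \<in> NCA_rels n d" for r :: "'k fa"
      using that by (rule NCA_rels_fsupp)
    show "pairing (\<lambda>w. F (run (act n d) s w)) r = 0"
      if "r \<in> NCA_rels n d" "s \<in> basis_index n d" "F None = 0" for r s and F :: "_ \<Rightarrow> 'k"
      using assms(1) that by (rule NCA_rels_pairing_zero)
  qed
  then show ?thesis using assms(3,4) by blast
qed

text \<open>The coefficient of the state \<open>g j\<close>, after running from the unit, isolates
  \<open>c j\<close>. The words need only reach pairwise different states, so the reduced words of a
  smaller S_{l+1} are covered along with the basis words.\<close>

lemma independent_words:
  fixes c :: "'j \<Rightarrow> 'k::comm_ring_1"
  assumes "d \<ge> 2" "finite J" "(\<lambda>u. \<Sum>j\<in>J. c j * mon (b j) u) \<in> NCA_ideal n d"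
    and run: "\<And>j. j \<in> J \<Longrightarrow> run (act n d) (id, None) (b j) = Some (g j)" and "inj_on g J"
    and "j \<in> J"
  shows "c j = 0"
proof -
  let ?F = "\<lambda>z. if z = Some (g j) then 1 else 0 :: 'k"
  have "(\<Sum>i\<in>J. c i * ?F (run (act n d) (id, None) (b i))) = 0"
    using NCA_ideal_pairing_zero[OF assms(1,3), of "(id, None)" ?F] assms(2)
    by (simp add: basis_index_None permutes_id pairing_sum_mon)
  moreover have "(\<Sum>i\<in>J. c i * ?F (run (act n d) (id, None) (b i))) = (\<Sum>i\<in>J. if i = j then c i else 0)"
    using run \<open>inj_on g J\<close> \<open>j \<in> J\<close> by (intro sum.cong) (auto simp: inj_on_def)
  ultimately show ?thesis using assms(2,6) by simp
qed

section \<open>Evaluating the basis words at the unit\<close>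

lemma run_beq:
  assumes "beq l u v" "l \<le> n" "d \<ge> 2" "s \<in> basis_index n d" "set u \<subseteq> {1..n}"
  shows "run (act n d) s u = run (act n d) s v"
  using assms(1,4,5)
proof (induction arbitrary: s rule: beq.induct)
  case (symI u v)
  then show ?case using beq_set by metis
next
  case (transI u v w)
  then show ?case using beq_set by metis
next
  case (braid i p q)
  have "run (act n d) s (p @ [i, Suc i, i]) = run (act n d) s (p @ [Suc i, i, Suc i])"
    unfolding run_append
  proof (intro Option.bind_cong refl)
    fix t assume "run (act n d) s p = Some t"
    then have "t \<in> basis_index n d"
      using run_closed[OF act_closed[OF assms(3)] braid.prems(1), of p t] braid.prems by auto
    then show "run (act n d) t [i, Suc i, i] = run (act n d) t [Suc i, i, Suc i]"
      using braid assms(2) by (intro act_braid) auto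
  qed
  then show ?case using run_append[of _ _ _ q] by (metis append.assoc)
next
  case (comm i j p q)
  have "run (act n d) s (p @ [i, j]) = run (act n d) s (p @ [j, i])"
    unfolding run_append
  proof (intro Option.bind_cong refl)
    fix t assume "run (act n d) s p = Some t"
    then have "t \<in> basis_index n d"
      using run_closed[OF act_closed[OF assms(3)] comm.prems(1), of p t] comm.prems by auto
    then show "run (act n d) t [i, j] = run (act n d) t [j, i]"
      using comm assms(2) by (intro act_comm) auto
  qed
  then show ?case using run_append[of _ _ _ q] by (metis append.assoc)
qed simp

text \<open>The value at position \<open>N\<close> exceeds all values to its left, and the
  descending word carries it one position to the left per letter; so every step is an ascent and no
  product vanishes.\<close>

lemma run_rev_upt_None:
  assumes "1 \<le> m" "m \<le> N" "N \<le> n" "\<And>x. x < N \<Longrightarrow> w x < w N"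
  shows "run (act n d) (w, None) (rev [m..<N]) = Some (w \<circ> perm_of_word (rev [m..<N]), None)"
  using assms(2,1,3,4)
proof (induction N arbitrary: w rule: dec_induct)
  case base
  then show ?case by simp
next
  case (step N)
  have "(w \<circ> transpose N (Suc N)) x < (w \<circ> transpose N (Suc N)) N" if "x < N" for x
    using that step.prems(3)[of x] by simp
  then have "run (act n d) (w \<circ> transpose N (Suc N), None) (rev [m..<N])
      = Some (w \<circ> transpose N (Suc N) \<circ> perm_of_word (rev [m..<N]), None)"
    using step.prems by (intro step.IH) auto
  moreover have "rev [m..<Suc N] = N # rev [m..<N]" using step.hyps by simp
  moreover have "act n d (w, None) N = Some (w \<circ> transpose N (Suc N), None)"
    using step.prems by (simp add: nil_act_def)
  ultimately show ?case by (simp only: run.simps bind.simps perm_of_word_Cons comp_assoc)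
qed

lemma run_canon:
  "c \<in> canon l \<Longrightarrow> l < n \<Longrightarrow> run (act n d) (id, None) c = Some (perm_of_word c, None)"
proof (induction l arbitrary: c)
  case (Suc l)
  let ?r = "\<lambda>m. rev [m..<Suc (Suc l)]"
  from Suc.prems obtain b m where
    c: "c = b @ ?r m" "b \<in> canon l" "m \<in> {1..Suc (Suc l)}" by (auto simp del: upt_Suc)
  have b: "perm_of_word b permutes {1..Suc l}"
    using perm_of_word_permutes[OF canon_letters[OF c(2)]] .
  \<comment> \<open>The prefix fixes \<open>Suc (Suc l)\<close> and keeps all smaller points, 0
    included, below it.\<close>
  have "perm_of_word b x < perm_of_word b (Suc (Suc l))" if "x < Suc (Suc l)" for x
  proof -
    have "perm_of_word b x \<le> Suc l"
      using permutes_in_image[OF b, of x] permutes_not_in[OF b, of x] that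
      by (cases "x \<in> {1..Suc l}") auto
    then show ?thesis using permutes_not_in[OF b, of "Suc (Suc l)"] by simp
  qed
  then have "run (act n d) (perm_of_word b, None) (?r m) = Some (perm_of_word b \<circ> perm_of_word (?r m), None)"
    using c(3) Suc.prems by (intro run_rev_upt_None) auto
  then show ?case using Suc.IH[OF c(2) Suc_lessD[OF Suc.prems(2)]] unfolding c(1)
    by (simp only: run_append perm_of_word_append bind.simps)
qed simp

text \<open>The reduced word is an unspecified choice, so ascents along it cannot be read off;
  \<open>run_beq\<close> replaces it by the canonical word, whose run is explicit.\<close>

lemma run_red_word:
  assumes "w permutes {1..Suc l}" "l < n" "d \<ge> 2"
  shows "run (act n d) (id, None) (red_word (Suc l) w) = Some (w, None)"
proof -
  obtain c where c: "c \<in> canon l" "beq l (red_word (Suc l) w) c" "perm_of_word c = w"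
    using red_word_canon[OF assms(1)] by blast
  have "set (red_word (Suc l) w) \<subseteq> {1..n}"
    using red_word_letters[OF assms(1)] assms(2) by auto
  then show ?thesis
    using run_beq[OF c(2) _ assms(3)] run_canon[OF c(1) assms(2)] c(3) assms(2)
    by (simp add: basis_index_None permutes_id)
qed

lemma run_rev_upt_Some:
  assumes "m \<le> N" "N \<le> n"
  shows "run (act n d) (w, Some (k, N)) (rev [m..<N]) = Some (w, Some (k, m))"
  using assms by (induction N rule: dec_induct) auto

lemma run_basis_word:
  assumes "n \<ge> 1" "d \<ge> 2" "j \<in> basis_index n d"
  shows "run (act n d) (id, None) (basis_word n j) = Some j"
proof -
  obtain l where n: "n = Suc l" using assms(1) by (cases n) auto
  obtain w o' where j: "j = (w, o')" by (cases j)
  have w: "w permutes {1..Suc l}" using assms(3) by (auto simp: j n basis_index_def)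
  note r = run_red_word[OF w _ assms(2), of n, unfolded n, simplified]
  show ?thesis
  proof (cases o')
    case None
    then show ?thesis using r by (simp add: j n basis_word_def)
  next
    case (Some p)
    obtain k m where p: "p = (k, m)" by (cases p)
    have km: "k \<in> {1..d-1}" "m \<in> {1..n}" using assms(3) by (auto simp: j Some p basis_index_Some)
    \<comment> \<open>The first \<open>n\<close> opens the tail with exponent 1, so
      \<open>run_replicate\<close> accounts for the other \<open>k'\<close> letters.\<close>
    obtain k' where k: "k = Suc k'" using km by (cases k) auto
    have "run (act n d) (w, None) (replicate k n) = Some (w, Some (k, n))"
      using run_replicate[of 1 k' d n w] km by (simp add: k)
    then show ?thesis using r km run_rev_upt_Some[of m n n d w k]
      by (simp add: j Some p basis_word_def run_append n del: upt_Suc)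
  qed
qed

section \<open>Spanning\<close>

lemma has_square_gen_ideal:
  assumes "has_square l u" "l \<le> l'" "set u \<subseteq> {1..l'}" "braid_rels l' \<subseteq> R"
    "{mon [i, i] | i. 1 \<le> i \<and> i \<le> l} \<subseteq> R"
  shows "mon u \<in> gen_ideal {1..l'} R"
proof -
  obtain p i q where i: "i \<in> {1..l}" and b: "beq l u (p @ [i, i] @ q)"
    using assms(1) unfolding has_square_def by blast
  have "mon [i, i] \<in> R" using i assms(5) by auto
  then have "mon (p @ [i, i] @ q) \<in> gen_ideal {1..l'} R"
    using beq_set[OF b] assms(3) by (intro gen_ideal_mon_context gen_ideal.gen) auto
  then show ?thesis using mon_gen_ideal_beq[OF beq_mono[OF b assms(2)] assms(3,4)] by blast
qed

lemma NC_word_span: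
  assumes "set u \<subseteq> {1..l}"
  shows "(mon u :: 'k::comm_ring_1 fa) \<in> NC_ideal l \<or>
    (\<exists>w\<in>{w. w permutes {1..Suc l}}. fsub (mon u) (mon (red_word (Suc l) w) :: 'k fa) \<in> NC_ideal l)"
proof -
  have R: "braid_rels l \<subseteq> NC_rels l" "{mon [i, i] | i. 1 \<le> i \<and> i \<le> l} \<subseteq> NC_rels l"
    unfolding NC_rels_def by blast+
  show ?thesis
    using word_red_word[OF assms] has_square_gen_ideal[OF _ _ assms R] beq_gen_ideal[OF _ assms R(1)]
      perm_of_word_permutes[OF assms]
    unfolding NC_ideal_def by blast
qed

text \<open>The analogue of \<open>has_square\<close> for the full algebra, where the letter
  \<open>n\<close> contributes its d-th power instead of its square; the ring enters only in
  \<open>nca_null_ideal\<close>.\<close>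

definition nca_null :: "nat \<Rightarrow> nat \<Rightarrow> nat list \<Rightarrow> bool" where
  "nca_null n d u \<longleftrightarrow>
     (\<exists>p z q. (z = replicate d n \<or> (\<exists>i\<in>{1..<n}. z = [i, i])) \<and> beq n u (p @ z @ q))"

lemma nca_null_square: "beq n u (p @ [i, i] @ q) \<Longrightarrow> i \<in> {1..<n} \<Longrightarrow> nca_null n d u"
  unfolding nca_null_def by blast

lemma nca_null_power: "nca_null n d (p @ replicate d n @ q)"
  unfolding nca_null_def using beq.reflI by blast

lemma has_square_nca_null: "has_square l u \<Longrightarrow> l < n \<Longrightarrow> nca_null n d u"
proof -
  assume "has_square l u" "l < n"
  then obtain p i q where "i \<in> {1..<n}" "beq n u (p @ [i, i] @ q)"
    unfolding has_square_def using beq_mono[of l u _ n] by fastforce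
  then show ?thesis using nca_null_square by blast
qed

lemma nca_null_beq: "nca_null n d v \<Longrightarrow> beq n u v \<Longrightarrow> nca_null n d u"
proof -
  assume "nca_null n d v" "beq n u v"
  then obtain p z q where "z = replicate d n \<or> (\<exists>i\<in>{1..<n}. z = [i, i])" "beq n v (p @ z @ q)"
    unfolding nca_null_def by blast
  moreover from this(2) have "beq n u (p @ z @ q)" by (rule beq.transI[OF \<open>beq n u v\<close>])
  ultimately show ?thesis unfolding nca_null_def by blast
qed

lemma nca_null_append: "nca_null n d u \<Longrightarrow> nca_null n d (u @ v)"
proof -
  assume "nca_null n d u"
  then obtain p z q where z: "z = replicate d n \<or> (\<exists>i\<in>{1..<n}. z = [i, i])" "beq n u (p @ z @ q)"
    unfolding nca_null_def by blast
  from z(2) have "beq n (u @ v) (p @ z @ q @ v)" using beq_right[of n u _ v] by fastforce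
  with z(1) show ?thesis unfolding nca_null_def by blast
qed

lemma nca_null_ideal:
  assumes "nca_null n d u" "set u \<subseteq> {1..n}"
  shows "(mon u :: 'k::comm_ring_1 fa) \<in> NCA_ideal n d"
proof -
  obtain p z q where z: "z = replicate d n \<or> (\<exists>i\<in>{1..<n}. z = [i, i])" and b: "beq n u (p @ z @ q)"
    using assms(1) unfolding nca_null_def by blast
  have "(mon z :: 'k fa) \<in> NCA_rels n d"
    using z unfolding NCA_rels_def by fastforce
  then have "(mon (p @ z @ q) :: 'k fa) \<in> NCA_ideal n d"
    unfolding NCA_ideal_def using beq_set[OF b] assms(2)
    by (intro gen_ideal_mon_context gen_ideal.gen) auto
  moreover have "braid_rels n \<subseteq> (NCA_rels n d :: 'k fa set)" by (auto simp: NCA_rels_def)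
  ultimately show ?thesis using mon_gen_ideal_beq[OF b assms(2)] unfolding NCA_ideal_def by blast
qed

lemma red_word_snoc:
  assumes "w permutes {1..Suc l}" "i \<in> {1..l}"
  shows "has_square l (red_word (Suc l) w @ [i])
    \<or> (\<exists>v. v permutes {1..Suc l} \<and> beq l (red_word (Suc l) w @ [i]) (red_word (Suc l) v))"
proof -
  have "set (red_word (Suc l) w @ [i]) \<subseteq> {1..l}" using red_word_letters[OF assms(1)] assms(2) by auto
  then show ?thesis using word_red_word perm_of_word_permutes by blast
qed

text \<open>The case distinction is that of \<open>act\<close>, with each formula replaced by the
  braid moves that produce it.\<close>

lemma basis_word_snoc:
  assumes "n \<ge> 1" "d \<ge> 2" "j \<in> basis_index n d" "i \<in> {1..n}"
  shows "nca_null n d (basis_word n j @ [i])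
    \<or> (\<exists>j'\<in>basis_index n d. beq n (basis_word n j @ [i]) (basis_word n j'))"
proof -
  obtain l where n: "n = Suc l" using assms(1) by (cases n) auto
  obtain w z where j: "j = (w, z)" by (cases j)
  have w: "w permutes {1..Suc l}" using assms(3) by (auto simp: j n basis_index_def)
  have basis: ?thesis if "basis_word n j @ [i] = basis_word n j'" "j' \<in> basis_index n d" for j'
    using that beq.reflI by metis
  show ?thesis
  proof (cases z)
    case None
    show ?thesis
    proof (cases "i = n")
      case True
      then show ?thesis using assms w
        by (intro basis[of "(w, Some (1, n))"]) (auto simp: j None basis_word_def basis_index_Some n)
    next
      case False
      then have "i \<in> {1..l}" using assms(4) n by auto
      from red_word_snoc[OF w this] show ?thesis
      proof
        assume "has_square l (red_word (Suc l) w @ [i])"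
        then show ?thesis using has_square_nca_null[of l _ n d] by (simp add: j None basis_word_def n)
      next
        assume "\<exists>v. v permutes {1..Suc l} \<and> beq l (red_word (Suc l) w @ [i]) (red_word (Suc l) v)"
        then obtain v where v: "v permutes {1..Suc l}" "beq l (red_word (Suc l) w @ [i]) (red_word (Suc l) v)"
          by blast
        then have "beq n (basis_word n j @ [i]) (basis_word n (v, None))"
          using beq_mono[of l _ _ n] by (simp add: j None basis_word_def n)
        then show ?thesis using v(1) basis_index_None[of v n d] n by blast
      qed
    qed
  next
    case (Some y)
    obtain k m where y: "y = (k, m)" by (cases y)
    have km: "k \<in> {1..d-1}" "m \<in> {1..n}" using assms(3) by (auto simp: j Some y basis_index_Some)
    let ?R = "red_word n w" and ?t = "replicate k n @ rev [m..<n]"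
    have bw: "basis_word n j = ?R @ ?t" by (simp add: j Some y basis_word_def)
    \<comment> \<open>If the new letter passes the whole tail, it emerges as a letter
      \<open>x \<le> l\<close> next to T_w, where the normal forms for S_n absorb it or produce a
      square.\<close>
    have move: ?thesis if b: "beq n (?t @ [i]) (x # ?t)" and x: "x \<in> {1..l}" for x
    proof -
      have b': "beq n (basis_word n j @ [i]) ((?R @ [x]) @ ?t)"
        using beq_left[OF b, of ?R] by (simp add: bw)
      from red_word_snoc[OF w x] show ?thesis
      proof
        assume "has_square l (red_word (Suc l) w @ [x])"
        then have "nca_null n d ((?R @ [x]) @ ?t)"
          unfolding n by (intro nca_null_append has_square_nca_null) auto
        then show ?thesis using b' nca_null_beq by blast
      next
        assume "\<exists>v. v permutes {1..Suc l} \<and> beq l (red_word (Suc l) w @ [x]) (red_word (Suc l) v)"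
        then obtain v where v: "v permutes {1..Suc l}" "beq l (red_word (Suc l) w @ [x]) (red_word (Suc l) v)"
          by blast
        have "beq n (?R @ [x]) (red_word n v)" using beq_mono[OF v(2), of n] n by simp
        then have "beq n (basis_word n j @ [i]) (red_word n v @ ?t)"
          using b' beq_right beq.transI by blast
        moreover have "red_word n v @ ?t = basis_word n (v, Some (k, m))" by (simp add: basis_word_def)
        moreover have "(v, Some (k, m)) \<in> basis_index n d" using v km n by (simp add: basis_index_Some)
        ultimately show ?thesis by metis
      qed
    qed
    have swap: "beq n (replicate k n @ [x]) (x # replicate k n)" if "x \<in> {1..n}" "x + 1 < n" for x
      using that by (intro beq_commute_letter) auto
    consider "Suc i < m" | "Suc i = m" | "i = m" "m < n" | "i = n" "m = n" | "m < i" "i < n"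
      | "i = n" "m < n" using km assms(4) by fastforce
    then show ?thesis
    proof cases
      case 1
      then show ?thesis using km assms(4)
        by (intro move[of i] beq_commute_letter) (auto simp: n)
    next
      case 2
      have "rev [i..<n] = rev [m..<n] @ [i]"
        using 2 km by (simp add: upt_conv_Cons)
      then show ?thesis using 2 km assms(4) w
        by (intro basis[of "(w, Some (k, i))"]) (auto simp: j Some y basis_word_def basis_index_Some n simp del: upt_Suc)
    next
      case 3
      have "rev [m..<n] = rev [Suc m..<n] @ [m]" using 3 by (simp add: upt_conv_Cons)
      then have "basis_word n j @ [i] = (?R @ replicate k n @ rev [Suc m..<n]) @ [i, i] @ []"
        using 3 by (simp add: bw)
      then have "beq n (basis_word n j @ [i]) ((?R @ replicate k n @ rev [Suc m..<n]) @ [i, i] @ [])"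
        using beq.reflI by metis
      then have "nca_null n d (basis_word n j @ [i])"
        by (rule nca_null_square) (use 3 assms(4) in auto)
      then show ?thesis ..
    next
      case 4
      have e: "basis_word n j @ [i] = ?R @ replicate (Suc k) n"
        using 4 by (simp add: bw replicate_append_same)
      show ?thesis
      proof (cases "Suc k < d")
        case True
        then show ?thesis using e km w 4 assms(1)
          by (intro basis[of "(w, Some (Suc k, n))"]) (simp add: basis_word_def, auto simp: basis_index_Some n)
      next
        case False
        then have "Suc k = d" using km by auto
        then show ?thesis using nca_null_power[of n d ?R "[]"] e by simp
      qed
    next
      case 5
      have "beq n (rev [m..<n] @ [i]) ((i - 1) # rev [m..<n])"
        using 5 km by (intro beq_rev_upt_greater) auto
      then have "beq n (?t @ [i]) ((replicate k n @ [i - 1]) @ rev [m..<n])"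
        using beq_left[of n _ _ "replicate k n"] by simp
      \<comment> \<open>After the shift the letter is at distance at least two from
        \<open>n\<close>, so it also passes T_n^k.\<close>
      moreover have "i - 1 \<in> {1..n}" "i - 1 + 1 < n" using 5 km by auto
      then have "beq n ((replicate k n @ [i - 1]) @ rev [m..<n]) ((i - 1) # ?t)"
        using beq_right[OF swap[of "i - 1"], of "rev [m..<n]"] by simp
      ultimately have "beq n (?t @ [i]) ((i - 1) # ?t)" using beq.transI by blast
      then show ?thesis using 5 km by (intro move[of "i - 1"]) (auto simp: n)
    next
      case 6
      obtain k' where k: "k = Suc k'" using km by (cases k) auto
      \<comment> \<open>One \<open>n\<close> of the power is prepended to the block, giving a
        descending word that starts at \<open>n\<close>; the sliding rule then sends the new
        \<open>n\<close> out on the left as \<open>n - 1\<close>, which is \<open>l\<close>.\<close>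
      have top: "beq n (n # rev [m..<n] @ [n]) (l # n # rev [m..<n])"
        using beq_rev_upt_greater[of m n "Suc n" n] 6 km by (simp add: n)
      show ?thesis
      proof (cases k')
        case 0
        then show ?thesis using top 6 km by (intro move[of l]) (auto simp: k n)
      next
        \<comment> \<open>For exponent at least 2 the emitted \<open>l\<close> meets another
          \<open>n\<close>: a second braid move on \<open>n, l, n\<close> puts an \<open>l\<close>
          next to the leading \<open>l\<close> of the block.\<close>
        case (Suc k'')
        let ?p = "?R @ replicate k'' n"
        have r: "rev [m..<n] = l # rev [m..<l]" using 6 km by (simp add: n)
        have l: "0 < l" "l < n" using 6 km n by auto
        have e1: "basis_word n j @ [i] = (?p @ [n]) @ n # rev [m..<n] @ [n]"
          using 6 by (simp add: bw k Suc replicate_append_same flip: replicate_Suc)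
        have e2: "(?p @ [n]) @ l # n # rev [m..<n] = ?p @ [Suc l, l, Suc l] @ rev [m..<n]"
          by (simp add: n)
        have e3: "?p @ [l, Suc l, l] @ rev [m..<n] = (?p @ [l, Suc l]) @ [l, l] @ rev [m..<l]"
          by (simp add: r)
        have "beq n (?p @ [Suc l, l, Suc l] @ rev [m..<n]) (?p @ [l, Suc l, l] @ rev [m..<n])"
          using l by (intro beq.symI[OF beq.braid])
        with beq_left[OF top, of "?p @ [n]"]
        have "beq n (basis_word n j @ [i]) ((?p @ [l, Suc l]) @ [l, l] @ rev [m..<l])"
          unfolding e1 e2 e3 by (rule beq.transI)
        then have "nca_null n d (basis_word n j @ [i])"
          by (rule nca_null_square) (use l in auto)
        then show ?thesis ..
      qed
    qed
  qed
qed

lemma NCA_word_span: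
  assumes "n \<ge> 1" "d \<ge> 2" "set u \<subseteq> {1..n}"
  shows "nca_null n d u \<or> (\<exists>j\<in>basis_index n d. beq n u (basis_word n j))"
  using assms(3)
proof (induction u rule: rev_induct)
  case Nil
  obtain l where n: "n = Suc l" using assms(1) by (cases n) auto
  have "\<not> has_square l []"
    unfolding has_square_def using beq_length by fastforce
  then have "beq l [] (red_word (Suc l) id)" using word_red_word[of "[]" l] by simp
  then have "beq n [] (basis_word n (id, None))"
    using beq_mono[of l _ _ n] by (simp add: basis_word_def n)
  then show ?case using basis_index_None[of id n d] permutes_id by blast
next
  case (snoc i u)
  then have "nca_null n d u \<or> (\<exists>j\<in>basis_index n d. beq n u (basis_word n j))" by simp
  then show ?case
  proof
    assume "nca_null n d u"
    then show ?thesis using nca_null_append by blast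
  next
    assume "\<exists>j\<in>basis_index n d. beq n u (basis_word n j)"
    then obtain j where j: "j \<in> basis_index n d" "beq n (u @ [i]) (basis_word n j @ [i])"
      using beq_right by blast
    have "i \<in> {1..n}" using snoc.prems by simp
    from basis_word_snoc[OF assms(1,2) j(1) this] show ?thesis
      using j(2) nca_null_beq beq.transI by blast
  qed
qed

section \<open>Counting the basis\<close>

lemma basis_index_eq:
  "basis_index n d = (\<lambda>w. (w, None)) ` {w. w permutes {1..n}}
     \<union> (\<lambda>(w, k, m). (w, Some (k, m))) ` ({w. w permutes {1..n}} \<times> {1..d-1} \<times> {1..n})"
  unfolding basis_index_def by (auto simp: image_iff)

lemma finite_basis_index: "finite (basis_index n d)"
  unfolding basis_index_eq by (simp add: finite_permutations)

lemma card_basis_index: "card (basis_index n d) = fact n * (1 + n * (d - 1))"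
proof -
  let ?P = "{w. w permutes {1..n}}"
  let ?A = "(\<lambda>w. (w, None :: (nat \<times> nat) option)) ` ?P"
  let ?B = "(\<lambda>(w, k, m). (w, Some (k, m))) ` (?P \<times> {1..d-1} \<times> {1..n})"
  have P: "finite ?P" "card ?P = fact n"
    by (simp_all add: finite_permutations card_permutations)
  have "card ?A = fact n" using P by (subst card_image) (auto simp: inj_on_def)
  moreover have "card ?B = fact n * ((d - 1) * n)"
    using P by (subst card_image) (auto simp: inj_on_def)
  moreover have "card (?A \<union> ?B) = card ?A + card ?B"
    using P by (intro card_Un_disjoint) auto
  ultimately show ?thesis unfolding basis_index_eq by (simp add: algebra_simps)
qed

section \<open>Embedding of the nil-Coxeter algebras\<close>

lemma NC_ideal_subset_NCA_ideal:
  assumes "l < n"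
  shows "(NC_ideal l :: 'k::comm_ring_1 fa set) \<subseteq> NCA_ideal n d"
proof -
  have "NC_rels l \<subseteq> (NCA_rels n d :: 'k fa set)"
  proof
    fix r :: "'k fa"
    assume "r \<in> NC_rels l"
    then consider (braid) i where "r = fsub (mon [i, Suc i, i]) (mon [Suc i, i, Suc i])" "0 < i" "i < l"
      | (comm) i j where "r = fsub (mon [i, j]) (mon [j, i])" "i \<in> {1..l}" "j \<in> {1..l}" "i + 1 < j \<or> j + 1 < i"
      | (square) i where "r = mon [i, i]" "1 \<le> i" "i \<le> l"
      unfolding NC_rels_def braid_rels_def by blast
    then show "r \<in> NCA_rels n d"
    proof cases
      case braid
      then have "i < n" using assms by simp
      then show ?thesis using braid unfolding NCA_rels_def braid_rels_def by blast
    next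
      case comm
      then have "i \<in> {1..n}" "j \<in> {1..n}" using assms by auto
      then show ?thesis using comm unfolding NCA_rels_def braid_rels_def by blast
    next
      case square
      then have "i \<le> n - 1" using assms by simp
      then show ?thesis using square unfolding NCA_rels_def by blast
    qed
  qed
  then show ?thesis unfolding NC_ideal_def NCA_ideal_def
    using assms gen_ideal_mono[of _ "{1..l}" "NC_rels l" "{1..n}" "NCA_rels n d"] by auto
qed

text \<open>Modulo \<open>NC_ideal l\<close>, \<open>f\<close> is a combination of reduced words of
  S_{l+1}, which then lies in the larger ideal. \<open>red_word (Suc l) w\<close> and
  \<open>red_word n w\<close> are separate choices, so its coefficients are killed by running these
  words directly rather than by comparing them with the basis words.\<close>

lemma NCA_ideal_inter_NC:
  fixes f :: "'k::comm_ring_1 fa"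
  assumes "d \<ge> 2" "l < n" "in_FA {1..l} f" "f \<in> NCA_ideal n d"
  shows "f \<in> NC_ideal l"
proof -
  let ?B = "{w. w permutes {1..Suc l}}"
  have B: "finite ?B" by (simp add: finite_permutations)
  obtain c where c: "fsub f (\<lambda>u. \<Sum>w\<in>?B. c w * mon (red_word (Suc l) w) u) \<in> NC_ideal l"
    using span_of_words[OF B NC_word_span[unfolded NC_ideal_def] assms(3)] unfolding NC_ideal_def by blast
  let ?g = "\<lambda>u. \<Sum>w\<in>?B. c w * mon (red_word (Suc l) w) u"
  have "fsub f (fsub f ?g) \<in> NCA_ideal n d"
    using gen_ideal_fsub c assms(4) NC_ideal_subset_NCA_ideal[OF assms(2), of d]
    unfolding NCA_ideal_def by blast
  then have g: "?g \<in> NCA_ideal n d" by (simp add: fsub_def)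
  have "c w = 0" if "w \<in> ?B" for w
    using assms(1) B g
  proof (rule independent_words)
    show "run (act n d) (id, None) (red_word (Suc l) v) = Some (v, None)" if "v \<in> ?B" for v
      using that assms by (intro run_red_word) auto
    show "inj_on (\<lambda>v. (v, None)) ?B" by (simp add: inj_on_def)
  qed (fact that)
  then have "?g = (\<lambda>u. 0)" by simp
  then show ?thesis using c by (simp add: fsub_def)
qed

text \<open>The last conjunct encodes the isomorphism with R_l: the inclusion of ideals makes the
  map T_i to T_i from the nil-Coxeter algebra well defined, its image is R_l by construction, and
  the second half says that its kernel is zero.\<close>

theorem theoremB:
  fixes n d :: nat
  assumes "n \<ge> 1" and "d \<ge> 2"
  shows "card (basis_index n d) = fact n * (1 + n * (d - 1))
    \<and> (\<forall>f :: 'k::comm_ring_1 fa. in_FA {1..n} f \<longrightarrow>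
          (\<exists>J c. finite J \<and> J \<subseteq> basis_index n d \<and>
             fsub f (\<lambda>u. \<Sum>j\<in>J. c j * mon (basis_word n j) u) \<in> NCA_ideal n d))
    \<and> (\<forall>J (c :: _ \<Rightarrow> 'k). finite J \<and> J \<subseteq> basis_index n d \<and>
          (\<lambda>u. \<Sum>j\<in>J. c j * mon (basis_word n j) u) \<in> NCA_ideal n d
          \<longrightarrow> (\<forall>j\<in>J. c j = 0))
    \<and> (\<forall>l \<in> {1..n-1}.
          (NC_ideal l :: 'k fa set) \<subseteq> NCA_ideal n d
        \<and> (\<forall>f :: 'k fa. in_FA {1..l} f \<and> f \<in> NCA_ideal n d \<longrightarrow> f \<in> NC_ideal l))"
proof (intro conjI)
  show "card (basis_index n d) = fact n * (1 + n * (d - 1))" by (rule card_basis_index)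
next
  have words: "mon u \<in> gen_ideal {1..n} (NCA_rels n d :: 'k fa set)
      \<or> (\<exists>j\<in>basis_index n d. fsub (mon u) (mon (basis_word n j)) \<in> gen_ideal {1..n} (NCA_rels n d :: 'k fa set))"
    if "set u \<subseteq> {1..n}" for u
    using NCA_word_span[OF assms that] nca_null_ideal[OF _ that, of d]
      beq_gen_ideal[OF _ that, of _ "NCA_rels n d"]
    unfolding NCA_ideal_def NCA_rels_def by blast
  show "\<forall>f :: 'k fa. in_FA {1..n} f \<longrightarrow>
          (\<exists>J c. finite J \<and> J \<subseteq> basis_index n d \<and>
             fsub f (\<lambda>u. \<Sum>j\<in>J. c j * mon (basis_word n j) u) \<in> NCA_ideal n d)"
  proof (intro allI impI)
    fix f :: "'k fa"
    assume "in_FA {1..n} f"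
    then have "\<exists>c. fsub f (\<lambda>u. \<Sum>j\<in>basis_index n d. c j * mon (basis_word n j) u) \<in> NCA_ideal n d"
      unfolding NCA_ideal_def by (rule span_of_words[OF finite_basis_index words, rotated])
    then show "\<exists>J c. finite J \<and> J \<subseteq> basis_index n d \<and>
        fsub f (\<lambda>u. \<Sum>j\<in>J. c j * mon (basis_word n j) u) \<in> NCA_ideal n d"
      using finite_basis_index by (intro exI[of _ "basis_index n d"]) simp
  qed
next
  show "\<forall>J (c :: _ \<Rightarrow> 'k). finite J \<and> J \<subseteq> basis_index n d \<and>
          (\<lambda>u. \<Sum>j\<in>J. c j * mon (basis_word n j) u) \<in> NCA_ideal n d
          \<longrightarrow> (\<forall>j\<in>J. c j = 0)"
  proof (intro allI impI ballI, elim conjE)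
    fix J c j
    assume J: "finite J" "J \<subseteq> basis_index n d" and j: "j \<in> J"
      and 0: "(\<lambda>u. \<Sum>j\<in>J. c j * mon (basis_word n j) u) \<in> (NCA_ideal n d :: 'k fa set)"
    from assms(2) J(1) 0 show "c j = 0"
    proof (rule independent_words)
      show "run (act n d) (id, None) (basis_word n i) = Some i" if "i \<in> J" for i
        using that J(2) assms by (intro run_basis_word) auto
    qed (use j in auto)
  qed
next
  show "\<forall>l \<in> {1..n-1}.
          (NC_ideal l :: 'k fa set) \<subseteq> NCA_ideal n d
        \<and> (\<forall>f :: 'k fa. in_FA {1..l} f \<and> f \<in> NCA_ideal n d \<longrightarrow> f \<in> NC_ideal l)"
  proof
    fix l assume "l \<in> {1..n-1}"
    then have "l < n" by auto
    then show "(NC_ideal l :: 'k fa set) \<subseteq> NCA_ideal n d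
        \<and> (\<forall>f :: 'k fa. in_FA {1..l} f \<and> f \<in> NCA_ideal n d \<longrightarrow> f \<in> NC_ideal l)"
      using NC_ideal_subset_NCA_ideal NCA_ideal_inter_NC[OF assms(2)] by blast
  qed
qed

end
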